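(* There exists a constant $C=C(r,k,n)$ such that, for every $W\subseteq J^{r}(D,\mathbb{R}^k)$ closed, semialgebraic and Whitney stratified (where $D\subset\mathbb{R}^n$ is a disk), and for every $f\in C^{r+1}(D,\mathbb{R}^k)$ we have $$\delta_W(f,D)\leq\mathrm{dist}_{C^{r+1}(D,\mathbb{R}^k)}(f,\Delta_W)\leq C\cdot\delta_W(f,D).$$
   Context: $D\subset\mathbb{R}^n$ is a closed Euclidean disk (ball) of positive radius. For $f=(f_1,\dots,f_k)\in C^r(D,\mathbb{R}^k)$, $j^rf(z)=(z,(\partial^\alpha f_i(z))_{1\le i\le k,\,|\alpha|\le r})$ is its $r$-th jet at $z$; the jet space $J^r(D,\mathbb{R}^k)$ is identified with $D\times J^r(n,k)$, where $J^r(n,k)$ is the Euclidean space of all such tuples of values of partial derivatives of order $\le r$, and $J^r_z(D,\mathbb{R}^k)$ is the fiber over $z$, with the Euclidean distance. $\|f\|_{C^\ell(D,\mathbb{R}^k)}=\sup_{z\in D}\left(\sum_{i=1}^k\sum_{|\alpha|\le \ell}|\partial^\alpha f_i(z)|^2\right)^{1/2}$, with induced distance $\mathrm{dist}_{C^\ell(D,\mathbb{R}^k)}$. A semialgebraic set $W$ is Whitney stratified if it is a finite disjoint union $W=\coprod_{j=1}^s W_j$ of connected Nash (smooth and semialgebraic) submanifolds such that whenever $W_{j_1}\subset\mathrm{clos}(W_{j_2})$ the pair satisfies Whitney condition (a): if $x_m\in W_{j_2}$, $x_m\to y\in W_{j_1}$ and $T_{x_m}W_{j_2}\to\tau$ in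 the Grassmannian, then $\tau\supseteq T_yW_{j_1}$. For $g\in C^{r+1}(D,\mathbb{R}^k)$, $g$ (or $j^rg$) is transverse to $W$ at $z\in D$ if $j^rg$ and, when $z\in\partial D$, also $(j^rg)|_{\partial D}$ are transverse to all strata of $W$ at $z$; it is transverse to $W$ if this holds at every $z\in D$. Set $\Delta_W=\{g\in C^{r+1}(D,\mathbb{R}^k): g\text{ is not transverse to }W\}$. For $z\in D$ let $\Sigma_{W,z}\subset J^{r+1}_z(D,\mathbb{R}^k)$ be the set of all $(r+1)$-jets at $z$ of maps that are not transverse to $W$ at $z$ (non-transversality at $z$ depends only on the $(r+1)$-jet at $z$), and $$\delta_W(f,D)=\inf_{z\in D}\mathrm{dist}\left(j^{r+1}f(z),\Sigma_{W,z}\right).$$ The distance to an empty set is $+\infty$. *)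

theory Defs
  imports "HOL-Analysis.Analysis"
begin

(* Values of partial derivatives, indexed by (i, \<alpha>): component i, multi-index \<alpha>.  All jet
   orders live in this one inner product space of finitely supported families; the Euclidean
   space J^r(n,k) is its finite-dimensional subspace jet_space r below. *)
typedef ('n, 'k) jet = "{x :: 'k \<times> ('n \<Rightarrow> nat) \<Rightarrow> real. finite {p. x p \<noteq> 0}}"
  morphisms jet_coord Jet
  by (rule exI[of _ "\<lambda>_. 0"]) simp

lemma finite_jet_supp: "finite {p. jet_coord x p \<noteq> 0}"
  using jet_coord[of x] by simp

lemma jet_eqI: "(\<And>p. jet_coord x p = jet_coord y p) \<Longrightarrow> x = y"
  by (simp add: jet_coord_inject[symmetric] fun_eq_iff)

instantiation jet :: (type, type) real_vector
begin

definition "0 = Jet (\<lambda>_. 0)"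
definition "x + y = Jet (\<lambda>p. jet_coord x p + jet_coord y p)"
definition "- x = Jet (\<lambda>p. - jet_coord x p)"
definition "x - y = Jet (\<lambda>p. jet_coord x p - jet_coord y p)"
definition "a *\<^sub>R x = Jet (\<lambda>p. a * jet_coord x p)"

lemma jet_coord_simps [simp]:
  "jet_coord 0 p = 0"
  "jet_coord (x + y) p = jet_coord x p + jet_coord y p"
  "jet_coord (- x) p = - jet_coord x p"
  "jet_coord (x - y) p = jet_coord x p - jet_coord y p"
  "jet_coord (a *\<^sub>R x) p = a * jet_coord x p"
proof -
  have fin: "finite ({p. jet_coord x p \<noteq> 0} \<union> {p. jet_coord y p \<noteq> 0})"
    by (simp add: finite_jet_supp)
  show "jet_coord 0 p = 0"
    by (simp add: zero_jet_def Jet_inverse)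
  show "jet_coord (x + y) p = jet_coord x p + jet_coord y p"
    unfolding plus_jet_def by (subst Jet_inverse) (auto intro: finite_subset[OF _ fin])
  show "jet_coord (- x) p = - jet_coord x p"
    unfolding uminus_jet_def by (subst Jet_inverse) (auto intro: finite_subset[OF _ fin])
  show "jet_coord (x - y) p = jet_coord x p - jet_coord y p"
    unfolding minus_jet_def by (subst Jet_inverse) (auto intro: finite_subset[OF _ fin])
  show "jet_coord (a *\<^sub>R x) p = a * jet_coord x p"
    unfolding scaleR_jet_def by (subst Jet_inverse) (auto intro: finite_subset[OF _ fin])
qed

instance
  by standard (auto intro!: jet_eqI simp: algebra_simps)

end

instantiation jet :: (type, type) real_inner
begin

definition "inner x y = (\<Sum>p | jet_coord x p \<noteq> 0. jet_coord x p * jet_coord y p)"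
definition "norm (x :: ('a, 'b) jet) = sqrt (inner x x)"
definition "dist (x :: ('a, 'b) jet) y = norm (x - y)"
definition "sgn (x :: ('a, 'b) jet) = x /\<^sub>R norm x"
definition [code del]:
  "(uniformity :: (('a, 'b) jet \<times> ('a, 'b) jet) filter) =
     (INF e\<in>{0 <..}. principal {(x, y). dist x y < e})"
definition [code del]:
  "open (U :: ('a, 'b) jet set) \<longleftrightarrow> (\<forall>x\<in>U. eventually (\<lambda>(x', y). x' = x \<longrightarrow> y \<in> U) uniformity)"

lemma inner_jet_eq_sum:
  assumes "finite A" "{p. jet_coord x p \<noteq> 0} \<subseteq> A"
  shows "inner x y = (\<Sum>p\<in>A. jet_coord x p * jet_coord y p)"
  unfolding inner_jet_def by (rule sum.mono_neutral_left) (use assms in auto)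

instance
proof
  fix x y z :: "('a, 'b) jet" and a :: real
  define A where "A = {p. jet_coord x p \<noteq> 0} \<union> {p. jet_coord y p \<noteq> 0}"
  have A: "finite A"
    by (simp add: A_def finite_jet_supp)
  have ix: "inner x w = (\<Sum>p\<in>A. jet_coord x p * jet_coord w p)"
    and iy: "inner y w = (\<Sum>p\<in>A. jet_coord y p * jet_coord w p)"
    and ixy: "inner (x + y) w = (\<Sum>p\<in>A. jet_coord (x + y) p * jet_coord w p)"
    and ia: "inner (a *\<^sub>R x) w = (\<Sum>p\<in>A. jet_coord (a *\<^sub>R x) p * jet_coord w p)"
    for w by (rule inner_jet_eq_sum[OF A]; auto simp: A_def)+
  show "inner x y = inner y x"
    by (simp add: ix iy mult.commute)
  show "inner (x + y) z = inner x z + inner y z"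
    by (simp add: ix iy ixy algebra_simps sum.distrib)
  show "inner (a *\<^sub>R x) y = a * inner x y"
    by (simp add: ix ia algebra_simps sum_distrib_left)
  show "0 \<le> inner x x"
    by (simp add: ix sum_nonneg)
  show "inner x x = 0 \<longleftrightarrow> x = 0"
    unfolding inner_jet_def using finite_jet_supp[of x]
    by (auto simp: sum_nonneg_eq_0_iff intro!: jet_eqI)
  show "norm x = sqrt (inner x x)"
    by (rule norm_jet_def)
  show "dist x y = norm (x - y)"
    by (rule dist_jet_def)
  show "sgn x = x /\<^sub>R norm x"
    by (rule sgn_jet_def)
  show "(uniformity :: (('a, 'b) jet \<times> ('a, 'b) jet) filter) =
      (INF e\<in>{0 <..}. principal {(x, y). dist x y < e})"
    by (rule uniformity_jet_def)
  show "open U \<longleftrightarrow> (\<forall>x\<in>U. eventually (\<lambda>(x', y). x' = x \<longrightarrow> y \<in> U) uniformity)"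
    for U :: "('a, 'b) jet set"
    by (rule open_jet_def)
qed

end

definition mi_order :: "('n::finite \<Rightarrow> nat) \<Rightarrow> nat" where
  "mi_order \<alpha> = (\<Sum>j\<in>UNIV. \<alpha> j)"

definition jet_space :: "nat \<Rightarrow> ('n::finite, 'k::finite) jet set" where
  "jet_space r = {x. \<forall>i \<alpha>. r < mi_order \<alpha> \<longrightarrow> jet_coord x (i, \<alpha>) = 0}"

definition jet_bundle :: "nat \<Rightarrow> (real^'n) set \<Rightarrow> ((real^'n) \<times> ('n::finite, 'k::finite) jet) set" where
  "jet_bundle r D = D \<times> jet_space r"

(* f is C^m on S.  V is the linear space of directions tangent to S, i.e. S is relatively open in
   a translate of V or, like a closed disk or an interval, a convex set with nonempty relative
   interior there; then the values of a derivative within S are unique on V.  For a closed disk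
   this is the class of maps that are C^m in the interior and whose derivatives up to order m
   extend continuously to the disk. *)
primrec Ck_on ::
  "nat \<Rightarrow> 'a set \<Rightarrow> 'a set \<Rightarrow> ('a::real_normed_vector \<Rightarrow> 'b::real_normed_vector) \<Rightarrow> bool" where
  "Ck_on 0 V S f \<longleftrightarrow> continuous_on S f"
| "Ck_on (Suc m) V S f \<longleftrightarrow> f differentiable_on S \<and>
     (\<forall>v\<in>V. Ck_on m V S (\<lambda>x. frechet_derivative f (at x within S) v))"

definition smooth_on :: "'a set \<Rightarrow> 'a set \<Rightarrow> ('a::real_normed_vector \<Rightarrow> 'b::real_normed_vector) \<Rightarrow> bool"
  where "smooth_on V S f \<longleftrightarrow> (\<forall>m. Ck_on m V S f)"

(* C^m(D, R^k).  Members are total functions, but only their values on D matter below. *)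
definition C_space :: "nat \<Rightarrow> (real^'n) set \<Rightarrow> (real^'n \<Rightarrow> real^'k::finite) set" where
  "C_space m D = {f. Ck_on m UNIV D f}"

definition partial_deriv ::
  "(real^'n) set \<Rightarrow> 'n \<Rightarrow> (real^'n \<Rightarrow> real) \<Rightarrow> real^'n \<Rightarrow> real" where
  "partial_deriv D j f = (\<lambda>x. frechet_derivative f (at x within D) (axis j 1))"

(* The order of differentiation is immaterial for the functions considered (C^m with m at least
   the order of \<alpha>, on a closed disk), so any list of directions with multiplicities \<alpha> will do. *)
definition multi_partial ::
  "(real^'n) set \<Rightarrow> ('n \<Rightarrow> nat) \<Rightarrow> (real^'n \<Rightarrow> real) \<Rightarrow> real^'n \<Rightarrow> real" where
  "multi_partial D \<alpha> f = foldr (partial_deriv D) (SOME js. \<forall>j. count_list js j = \<alpha> j) f"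

definition jet_prolong ::
  "nat \<Rightarrow> (real^'n) set \<Rightarrow> (real^'n \<Rightarrow> real^'k::finite) \<Rightarrow> real^'n \<Rightarrow> (real^'n) \<times> ('n, 'k) jet" where
  "jet_prolong r D f z =
     (z, Jet (\<lambda>(i, \<alpha>). if mi_order \<alpha> \<le> r then multi_partial D \<alpha> (\<lambda>x. f x $ i) z else 0))"

lemma finite_mi_order_le: "finite {\<alpha> :: 'n::finite \<Rightarrow> nat. mi_order \<alpha> \<le> r}"
proof (rule finite_subset)
  show "{\<alpha> :: 'n \<Rightarrow> nat. mi_order \<alpha> \<le> r} \<subseteq> Pi\<^sub>E UNIV (\<lambda>_. {..r})"
    unfolding mi_order_def using member_le_sum[of _ "UNIV :: 'n set"]
    by (auto intro: order_trans)
  show "finite (Pi\<^sub>E (UNIV :: 'n set) (\<lambda>_. {..r}))"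
    by (intro finite_PiE) auto
qed

lemma jet_coord_jet_prolong:
  "jet_coord (snd (jet_prolong r D f z)) (i, \<alpha>) =
     (if mi_order \<alpha> \<le> r then multi_partial D \<alpha> (\<lambda>x. f x $ i) z else 0)"
proof -
  have "finite ((UNIV :: 'b set) \<times> {\<alpha> :: 'a \<Rightarrow> nat. mi_order \<alpha> \<le> r})"
    by (simp add: finite_mi_order_le)
  then have "finite {p :: 'b \<times> ('a \<Rightarrow> nat).
      (case p of (i, \<alpha>) \<Rightarrow> if mi_order \<alpha> \<le> r then multi_partial D \<alpha> (\<lambda>x. f x $ i) z else 0) \<noteq> 0}"
    by (rule rev_finite_subset) (auto split: if_splits)
  then show ?thesis
    by (simp add: jet_prolong_def Jet_inverse)
qed

definition C_norm :: "nat \<Rightarrow> (real^'n) set \<Rightarrow> (real^'n \<Rightarrow> real^'k::finite) \<Rightarrow> ennreal" where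
  "C_norm l D f = (SUP z\<in>D. ennreal (sqrt (\<Sum>i\<in>UNIV. \<Sum>\<alpha> | mi_order \<alpha> \<le> l.
     (multi_partial D \<alpha> (\<lambda>x. f x $ i) z)\<^sup>2)))"

definition C_dist_set ::
  "nat \<Rightarrow> (real^'n) set \<Rightarrow> (real^'n \<Rightarrow> real^'k::finite) \<Rightarrow> (real^'n \<Rightarrow> real^'k) set \<Rightarrow> ennreal" where
  "C_dist_set l D f G = (INF g\<in>G. C_norm l D (\<lambda>x. f x - g x))"

(* Semialgebraic subsets of a finite-dimensional space V. *)
inductive semialgebraic :: "'a::real_normed_vector set \<Rightarrow> 'a set \<Rightarrow> bool" for V where
  pos: "real_polynomial_function p \<Longrightarrow> semialgebraic V {x \<in> V. 0 < p x}"
| compl: "semialgebraic V S \<Longrightarrow> semialgebraic V (V - S)"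
| union: "semialgebraic V S \<Longrightarrow> semialgebraic V T \<Longrightarrow> semialgebraic V (S \<union> T)"

(* Velocities are one-sided, so that closed disks and, more generally, submanifolds with boundary
   are covered: at a boundary point they fill a half-space of the tangent space, hence the span.
   At interior points the velocities already form a linear space. *)
definition tangent_space :: "'a::real_normed_vector set \<Rightarrow> 'a \<Rightarrow> 'a set" where
  "tangent_space S p = span {v. \<exists>\<gamma> :: real \<Rightarrow> 'a. smooth_on UNIV {0..1} \<gamma> \<and> \<gamma> ` {0..1} \<subseteq> S \<and>
     \<gamma> 0 = p \<and> (\<gamma> has_vector_derivative v) (at 0 within {0..1})}"

(* Embedded Nash submanifold of the finite-dimensional space V.  Submanifolds of the manifold with
   boundary D \<times> J^r(n,k), such as D \<times> N, may themselves have a boundary: B is the set of points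
   at which half-space charts are allowed. *)
definition nash_submanifold :: "'a::real_inner set \<Rightarrow> 'a set \<Rightarrow> 'a set \<Rightarrow> bool" where
  "nash_submanifold V B S \<longleftrightarrow> S \<subseteq> V \<and> semialgebraic V S \<and>
     (\<forall>p\<in>S. \<exists>U \<phi> \<psi> L.
        p \<in> U \<and> openin (top_of_set V) U \<and> openin (top_of_set V) (\<phi> ` U) \<and>
        homeomorphism U (\<phi> ` U) \<phi> \<psi> \<and> smooth_on V U \<phi> \<and> smooth_on V (\<phi> ` U) \<psi> \<and>
        subspace L \<and> L \<subseteq> V \<and>
        (\<phi> ` (S \<inter> U) = L \<inter> \<phi> ` U \<or>
         p \<in> B \<and> (\<exists>l\<in>L. l \<noteq> 0 \<and> \<phi> ` (S \<inter> U) = {x \<in> L. 0 \<le> l \<bullet> x} \<inter> \<phi> ` U)))"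

definition orth_proj :: "'a::real_inner set \<Rightarrow> 'a \<Rightarrow> 'a" where
  "orth_proj T x = (THE y. y \<in> T \<and> (\<forall>t\<in>T. (x - y) \<bullet> t = 0))"

(* Convergence of finite-dimensional subspaces in the Grassmannian.  Subspaces of different
   dimensions are at distance at least 1. *)
definition grassmann_tendsto :: "(nat \<Rightarrow> 'a::real_inner set) \<Rightarrow> 'a set \<Rightarrow> bool" where
  "grassmann_tendsto T \<tau> \<longleftrightarrow> (\<lambda>m. onorm (\<lambda>x. orth_proj (T m) x - orth_proj \<tau> x)) \<longlonglongrightarrow> 0"

definition whitney_a :: "'a::real_inner set \<Rightarrow> 'a set \<Rightarrow> 'a set \<Rightarrow> bool" where
  "whitney_a V S1 S2 \<longleftrightarrow> (\<forall>x y \<tau>. (\<forall>m. x m \<in> S2) \<and> y \<in> S1 \<and> x \<longlonglongrightarrow> y \<and>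
     subspace \<tau> \<and> \<tau> \<subseteq> V \<and> grassmann_tendsto (\<lambda>m. tangent_space S2 (x m)) \<tau> \<longrightarrow>
     tangent_space S1 y \<subseteq> \<tau>)"

definition whitney_stratification :: "'a::real_inner set \<Rightarrow> 'a set \<Rightarrow> 'a set set \<Rightarrow> 'a set \<Rightarrow> bool" where
  "whitney_stratification V B \<S> W \<longleftrightarrow> finite \<S> \<and> disjoint \<S> \<and> \<Union>\<S> = W \<and>
     (\<forall>S\<in>\<S>. S \<noteq> {} \<and> connected S \<and> nash_submanifold V B S) \<and>
     (\<forall>S1\<in>\<S>. \<forall>S2\<in>\<S>. S1 \<subseteq> closure S2 \<longrightarrow> whitney_a V S1 S2)"

(* The map F : M \<rightarrow> V is transverse to S at z. *)
definition transverse_at ::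
  "'b::real_normed_vector set \<Rightarrow> ('a::real_normed_vector \<Rightarrow> 'b) \<Rightarrow> 'a set \<Rightarrow> 'b set \<Rightarrow> 'a \<Rightarrow> bool" where
  "transverse_at V F M S z \<longleftrightarrow> (F z \<in> S \<longrightarrow>
     {frechet_derivative F (at z within M) v + w | v w.
        v \<in> tangent_space M z \<and> w \<in> tangent_space S (F z)} = V)"

definition jet_transverse_at ::
  "nat \<Rightarrow> (real^'n) set \<Rightarrow> ((real^'n) \<times> ('n, 'k::finite) jet) set set \<Rightarrow> (real^'n \<Rightarrow> real^'k) \<Rightarrow> real^'n \<Rightarrow> bool" where
  "jet_transverse_at r D \<S> g z \<longleftrightarrow> (\<forall>S\<in>\<S>.
     transverse_at (jet_bundle r UNIV) (jet_prolong r D g) D S z \<and>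
     (z \<in> frontier D \<longrightarrow>
       transverse_at (jet_bundle r UNIV) (jet_prolong r D g) (frontier D) S z))"

definition non_transverse_maps ::
  "nat \<Rightarrow> (real^'n) set \<Rightarrow> ((real^'n) \<times> ('n, 'k::finite) jet) set set \<Rightarrow> (real^'n \<Rightarrow> real^'k) set" where
  "non_transverse_maps r D \<S> =
     {g \<in> C_space (r + 1) D. \<not> (\<forall>z\<in>D. jet_transverse_at r D \<S> g z)}"

definition non_transverse_jets ::
  "nat \<Rightarrow> (real^'n) set \<Rightarrow> ((real^'n) \<times> ('n, 'k::finite) jet) set set \<Rightarrow> real^'n \<Rightarrow> ((real^'n) \<times> ('n, 'k) jet) set" where
  "non_transverse_jets r D \<S> z =
     {jet_prolong (r + 1) D g z | g. g \<in> C_space (r + 1) D \<and> \<not> jet_transverse_at r D \<S> g z}"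

definition delta ::
  "nat \<Rightarrow> (real^'n) set \<Rightarrow> ((real^'n) \<times> ('n, 'k::finite) jet) set set \<Rightarrow> (real^'n \<Rightarrow> real^'k) \<Rightarrow> ennreal" where
  "delta r D \<S> f =
     (INF z\<in>D. INF \<sigma>\<in>non_transverse_jets r D \<S> z. ennreal (dist (jet_prolong (r + 1) D f z) \<sigma>))"

end

(* The (r+1)-jet of g at z determines the derivative of j^r g at z in all directions that are
   velocities of curves in D, hence on the tangent spaces of D and of its boundary; so it decides
   transversality at z.  The first inequality then compares jets at a point where a map is not
   transverse.  For the second, given a non-transverse jet sigma at z, subtract from f a map p
   with j^(r+1) p (z) = j^(r+1) f (z) - sigma and C^(r+1)-norm at most C times the size of that
   jet; p is built from bounded functions (products of combinations of powers of sines), so C does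
   not depend on the radius of D. *)
theory Submission
  imports Defs
begin

text \<open>The obvious candidate for p, the Taylor polynomial with the required jet at z, has
  derivatives on D that grow with the radius. What is needed instead is a function on the whole
  space whose derivatives of order at most r + 1 have bounds independent of D and z. Sines supply
  this, and their successive derivatives can be written down explicitly, so the partial derivatives
  of p are known in closed form. The other difficulty is what a derivative means at boundary points.
  Within the disk it is unique, because the disk is convex with nonempty interior. Within the
  bounding sphere it is determined only on the tangent space, and \<open>frechet_derivative\<close>
  is an arbitrary choice elsewhere; the argument may therefore compare derivatives there only on
  tangent vectors. Finally, \<open>multi_partial\<close> differentiates along an unspecified list of
  directions, so the symmetry of partial derivatives has to be available on all of D, boundary
  included, before jets can be differentiated.\<close>

section \<open>Bounded functions of one variable with prescribed derivatives at 0\<close>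

text \<open>The whole sequence of derivatives is carried along with the function \<open>e 0\<close>,
  so that later formulas can name each derivative explicitly. The bound may depend on the order
  \<open>l\<close>.\<close>

definition bounded_chain :: "(nat \<Rightarrow> real \<Rightarrow> real) \<Rightarrow> bool" where
  "bounded_chain e \<longleftrightarrow> (\<forall>l t. (e l has_real_derivative e (Suc l) t) (at t)) \<and>
     (\<forall>l. \<exists>K. \<forall>t. \<bar>e l t\<bar> \<le> K)"

lemma bounded_chain_one: "bounded_chain (\<lambda>l t. if l = 0 then 1 else 0)"
proof -
  have "\<exists>K. \<forall>t::real. \<bar>if l = 0 then 1 else 0\<bar> \<le> (K::real)" for l :: nat
    by (rule exI[of _ 1]) auto
  moreover have "((\<lambda>t. if l = 0 then 1 else 0) has_real_derivative 0) (at t)" for l :: nat and t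
    by (cases "l = 0") auto
  ultimately show ?thesis
    by (simp add: bounded_chain_def)
qed

text \<open>Each differentiation of the sine advances its phase by a quarter period.\<close>

lemma bounded_chain_sin: "bounded_chain (\<lambda>l t. sin (t + real l * (pi / 2)))"
proof -
  have "((\<lambda>t. sin (t + real l * (pi / 2))) has_real_derivative
      sin (t + real (Suc l) * (pi / 2))) (at t)" for l t
  proof -
    have "cos (t + real l * (pi / 2)) = sin ((t + real l * (pi / 2)) + pi / 2)"
      by (simp only: sin_add) simp
    moreover have "(t + real l * (pi / 2)) + pi / 2 = t + real (Suc l) * (pi / 2)"
      by (simp add: algebra_simps)
    ultimately have eq: "cos (t + real l * (pi / 2)) = sin (t + real (Suc l) * (pi / 2))"
      by metis
    have "((\<lambda>t. sin (t + real l * (pi / 2))) has_real_derivative cos (t + real l * (pi / 2))) (at t)"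
      by (auto intro!: derivative_eq_intros)
    then show ?thesis
      unfolding eq .
  qed
  moreover have "\<exists>K. \<forall>t. \<bar>sin (t + real l * (pi / 2))\<bar> \<le> K" for l
    by (rule exI[of _ 1]) simp
  ultimately show ?thesis
    by (simp add: bounded_chain_def)
qed

lemma bounded_chain_add:
  assumes "bounded_chain a" "bounded_chain b"
  shows "bounded_chain (\<lambda>l t. a l t + b l t)"
  unfolding bounded_chain_def
proof (intro conjI allI)
  show "((\<lambda>t. a l t + b l t) has_real_derivative a (Suc l) t + b (Suc l) t) (at t)" for l t
    using assms by (auto simp: bounded_chain_def intro!: derivative_intros)
  fix l
  obtain K L where "\<forall>t. \<bar>a l t\<bar> \<le> K" "\<forall>t. \<bar>b l t\<bar> \<le> L"
    using assms unfolding bounded_chain_def by meson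
  then have "\<bar>a l t + b l t\<bar> \<le> K + L" for t
    by (meson abs_triangle_ineq add_mono order_trans)
  then show "\<exists>K. \<forall>t. \<bar>a l t + b l t\<bar> \<le> K"
    by blast
qed

lemma bounded_chain_scale:
  assumes "bounded_chain a"
  shows "bounded_chain (\<lambda>l t. c * a l t)"
  unfolding bounded_chain_def
proof (intro conjI allI)
  show "((\<lambda>t. c * a l t) has_real_derivative c * a (Suc l) t) (at t)" for l t
    using assms by (auto simp: bounded_chain_def intro!: DERIV_cmult)
  fix l
  obtain K where "\<forall>t. \<bar>a l t\<bar> \<le> K"
    using assms unfolding bounded_chain_def by meson
  then have "\<bar>c * a l t\<bar> \<le> \<bar>c\<bar> * K" for t
    by (simp add: abs_mult mult_left_mono)
  then show "\<exists>K. \<forall>t. \<bar>c * a l t\<bar> \<le> K"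
    by blast
qed

lemma bounded_chain_sum:
  assumes "finite A" "\<And>i. i \<in> A \<Longrightarrow> bounded_chain (a i)"
  shows "bounded_chain (\<lambda>l t. \<Sum>i\<in>A. a i l t)"
  using assms
proof (induction A rule: finite_induct)
  case empty
  then show ?case
    by (auto simp: bounded_chain_def)
next
  case (insert i A)
  then show ?case
    using bounded_chain_add[of "a i"] by simp
qed

text \<open>This is the Leibniz formula for the \<open>l\<close>-th derivative of a product.
  Differentiating it once more gives two sums, which Pascal's rule merges into the formula for
  \<open>Suc l\<close>.\<close>

lemma bounded_chain_mult:
  assumes a: "bounded_chain a" and b: "bounded_chain b"
  shows "bounded_chain (\<lambda>l t. \<Sum>k\<le>l. real (l choose k) * a k t * b (l - k) t)"
  unfolding bounded_chain_def
proof (intro conjI allI)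
  fix l t
  have da: "(a k has_real_derivative a (Suc k) t) (at t)"
    and db: "(b k has_real_derivative b (Suc k) t) (at t)" for k
    using assms by (auto simp: bounded_chain_def)
  have "((\<lambda>t. \<Sum>k\<le>l. real (l choose k) * a k t * b (l - k) t) has_real_derivative
      (\<Sum>k\<le>l. real (l choose k) * (a (Suc k) t * b (l - k) t + a k t * b (Suc (l - k)) t))) (at t)"
    by (rule DERIV_sum) (rule derivative_eq_intros da db refl | simp add: algebra_simps)+
  also have "(\<Sum>k\<le>l. real (l choose k) * (a (Suc k) t * b (l - k) t + a k t * b (Suc (l - k)) t))
     = (\<Sum>k\<le>l. real (l choose k) * a (Suc k) t * b (l - k) t)
       + (\<Sum>k\<le>l. real (l choose k) * a k t * b (Suc l - k) t)"
    by (simp add: algebra_simps sum.distrib Suc_diff_le)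
  \<comment> \<open>The added term is zero, since \<open>l choose Suc l = 0\<close>.\<close>
  also have "(\<Sum>k\<le>l. real (l choose k) * a k t * b (Suc l - k) t)
     = (\<Sum>k\<le>Suc l. real (l choose k) * a k t * b (Suc l - k) t)"
    by simp
  also have "\<dots> = a 0 t * b (Suc l) t + (\<Sum>k\<le>l. real (l choose Suc k) * a (Suc k) t * b (l - k) t)"
    by (subst sum.atMost_Suc_shift) simp
  \<comment> \<open>With the index shifted, the coefficients of
    \<open>a (Suc k) t * b (l - k) t\<close> add up by Pascal's rule.\<close>
  also have "(\<Sum>k\<le>l. real (l choose k) * a (Suc k) t * b (l - k) t) + \<dots>
     = (\<Sum>k\<le>Suc l. real (Suc l choose k) * a k t * b (Suc l - k) t)"
    by (simp add: sum.atMost_Suc_shift algebra_simps sum.distrib del: sum.atMost_Suc)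
  finally show "((\<lambda>t. \<Sum>k\<le>l. real (l choose k) * a k t * b (l - k) t) has_real_derivative
      (\<Sum>k\<le>Suc l. real (Suc l choose k) * a k t * b (Suc l - k) t)) (at t)" .
next
  fix l
  obtain K where K: "\<bar>a k t\<bar> \<le> K k" for k t
    using a unfolding bounded_chain_def by metis
  obtain L where L: "\<bar>b k t\<bar> \<le> L k" for k t
    using b unfolding bounded_chain_def by metis
  have "\<bar>\<Sum>k\<le>l. real (l choose k) * a k t * b (l - k) t\<bar> \<le> (\<Sum>k\<le>l. real (l choose k) * K k * L (l - k))" for t
  proof (rule order_trans[OF sum_abs sum_mono])
    fix k
    have "0 \<le> K k"
      using K[of k t] by linarith
    then show "\<bar>real (l choose k) * a k t * b (l - k) t\<bar> \<le> real (l choose k) * K k * L (l - k)"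
      unfolding abs_mult by (intro mult_mono K L) auto
  qed
  then show "\<exists>K. \<forall>t. \<bar>\<Sum>k\<le>l. real (l choose k) * a k t * b (l - k) t\<bar> \<le> K"
    by blast
qed

text \<open>The function is sin^m / m!, which behaves like t^m / m! at 0. The induction multiplies
  by sin / (m + 1) and reads off the derivatives from the Leibniz formula.\<close>

lemma ex_bounded_chain_vanishing:
  "\<exists>e. bounded_chain e \<and> (\<forall>l<m. e l 0 = 0) \<and> e m 0 = 1"
proof (induction m)
  case 0
  show ?case
    using bounded_chain_one by auto
next
  case (Suc m)
  then obtain e where e: "bounded_chain e" "\<And>l. l < m \<Longrightarrow> e l 0 = 0" "e m 0 = 1"
    by blast
  define s where "s = (\<lambda>l t. sin (t + real l * (pi / 2)))"
  define g where "g = (\<lambda>l t. inverse (real (Suc m)) *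
    (\<Sum>k\<le>l. real (l choose k) * e k t * s (l - k) t))"
  have "bounded_chain g"
    unfolding g_def s_def by (intro bounded_chain_scale bounded_chain_mult e bounded_chain_sin)
  moreover have "g l 0 = 0" if "l < Suc m" for l
  proof -
    \<comment> \<open>Either \<open>k < m\<close> and the first factor vanishes, or
      \<open>k = l = m\<close> and the second factor is sin 0.\<close>
    have "e k 0 * s (l - k) 0 = 0" if "k \<le> l" for k
      using that \<open>l < Suc m\<close> e(2)[of k] by (cases "k < m") (auto simp: s_def)
    then have "(\<Sum>k\<le>l. real (l choose k) * e k 0 * s (l - k) 0) = 0"
      by (intro sum.neutral) auto
    then show ?thesis
      by (simp add: g_def)
  qed
  moreover have "g (Suc m) 0 = 1"
  proof -
    have "(\<Sum>k\<le>Suc m. real (Suc m choose k) * e k 0 * s (Suc m - k) 0)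
        = (\<Sum>k\<in>{m}. real (Suc m choose k) * e k 0 * s (Suc m - k) 0)"
    proof (rule sum.mono_neutral_right)
      have "e k 0 * s (Suc m - k) 0 = 0" if "k \<le> Suc m" "k \<noteq> m" for k
        using that e(2)[of k] by (cases "k < m") (auto simp: s_def)
      then show "\<forall>k\<in>{..Suc m} - {m}. real (Suc m choose k) * e k 0 * s (Suc m - k) 0 = 0"
        by (simp add: mult.assoc)
    qed auto
    also have "\<dots> = real (Suc m)"
      by (simp add: e(3) s_def)
    finally show ?thesis
      by (simp add: g_def)
  qed
  ultimately show ?case
    by blast
qed

text \<open>The jets at 0 of sin^m / m! form a triangular system with ones on the diagonal, which is
  solved from \<open>m = N\<close> downwards: this is why the induction runs on
  \<open>N - m\<close>.\<close>

lemma ex_bounded_chain_dual: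
  assumes "m \<le> N"
  shows "\<exists>e. bounded_chain e \<and> (\<forall>l\<le>N. e l 0 = (if l = m then 1 else 0))"
  using assms
proof (induction "N - m" arbitrary: m rule: less_induct)
  case less
  have "\<exists>e. bounded_chain e \<and> (\<forall>l\<le>N. e l 0 = (if l = k then 1 else 0))" if "k \<in> {m<..N}" for k
    by (rule less.hyps) (use less.prems that in auto)
  then obtain E where E: "\<And>k. k \<in> {m<..N} \<Longrightarrow> bounded_chain (E k)"
    "\<And>k l. k \<in> {m<..N} \<Longrightarrow> l \<le> N \<Longrightarrow> E k l 0 = (if l = k then 1 else 0)"
    by metis
  obtain g where g: "bounded_chain g" "\<And>l. l < m \<Longrightarrow> g l 0 = 0" "g m 0 = 1"
    using ex_bounded_chain_vanishing[of m] by blast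
  \<comment> \<open>The derivatives of \<open>g\<close> of orders \<open>m + 1\<close> to
    \<open>N\<close> are cancelled by the dual functions already found for those orders. These do
    not disturb orders up to \<open>m\<close>, where their derivatives at 0 vanish.\<close>
  define e where "e = (\<lambda>l t. g l t + (\<Sum>k\<in>{m<..N}. - g k 0 * E k l t))"
  have "bounded_chain e"
    unfolding e_def by (intro bounded_chain_add g bounded_chain_sum bounded_chain_scale E) auto
  moreover have "e l 0 = (if l = m then 1 else 0)" if "l \<le> N" for l
  proof -
    have "(\<Sum>k\<in>{m<..N}. - g k 0 * E k l 0) = (\<Sum>k\<in>{m<..N}. if l = k then - g k 0 else 0)"
      by (rule sum.cong) (use E that in auto)
    also have "\<dots> = (if m < l then - g l 0 else 0)"
      using that by (subst sum.delta') auto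
    finally show ?thesis
      using g by (auto simp: e_def)
  qed
  ultimately show ?case
    by blast
qed

text \<open>Derivatives exist for every order \<open>l\<close>, but one common bound
  \<open>K\<close> is possible only for the finitely many pairs with \<open>m\<close> and
  \<open>l\<close> at most \<open>N\<close>.\<close>

lemma ex_bounded_chains_dual:
  obtains d :: "nat \<Rightarrow> nat \<Rightarrow> real \<Rightarrow> real" and K :: real
  where "\<And>m l t. m \<le> N \<Longrightarrow> (d m l has_real_derivative d m (Suc l) t) (at t)"
    and "\<And>m l. m \<le> N \<Longrightarrow> l \<le> N \<Longrightarrow> d m l 0 = (if l = m then 1 else 0)"
    and "\<And>m l t. m \<le> N \<Longrightarrow> l \<le> N \<Longrightarrow> \<bar>d m l t\<bar> \<le> K"
    and "0 < K"
proof -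
  obtain d where d: "\<And>m. m \<le> N \<Longrightarrow> bounded_chain (d m)"
    "\<And>m l. m \<le> N \<Longrightarrow> l \<le> N \<Longrightarrow> d m l 0 = (if l = m then 1 else 0)"
    using ex_bounded_chain_dual[of _ N] by metis
  have "\<exists>K. \<forall>t. \<bar>d m l t\<bar> \<le> K" if "m \<le> N" for m l
    using d(1)[OF that] unfolding bounded_chain_def by blast
  then obtain K where K: "\<And>m l t. m \<le> N \<Longrightarrow> \<bar>d m l t\<bar> \<le> K m l"
    by metis
  define M where "M = Max ((\<lambda>(m, l). K m l) ` ({..N} \<times> {..N}))"
  have M: "\<bar>d m l t\<bar> \<le> M" if "m \<le> N" "l \<le> N" for m l t
  proof -
    have "K m l \<le> M"
      unfolding M_def by (rule Max_ge) (use that in auto)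
    then show ?thesis
      using K[OF that(1), of l t] by linarith
  qed
  have "0 < M"
    using M[of 0 0 0] d(2)[of 0 0] by simp
  then show thesis
    using that[of d M] d M unfolding bounded_chain_def by blast
qed

section \<open>Derivatives within a set and the extent of their uniqueness\<close>

text \<open>By the chain rule both values are the derivative at 0 of
  \<open>f \<circ> \<gamma>\<close> on \<open>{0..1}\<close>, and a derivative on a nondegenerate
  interval is unique, also at an endpoint.\<close>

lemma has_derivative_eq_on_velocity:
  fixes f :: "'a::real_normed_vector \<Rightarrow> 'b::real_normed_vector"
  assumes "(f has_derivative f1) (at p within M)" "(f has_derivative f2) (at p within M)"
    and "\<gamma> 0 = p" "\<gamma> ` {0..1} \<subseteq> M" "(\<gamma> has_vector_derivative v) (at 0 within {0..1})"
  shows "f1 v = f2 v"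
proof -
  have "((f \<circ> \<gamma>) has_vector_derivative f' v) (at 0 within {0..1})"
    if "(f has_derivative f') (at p within M)" for f'
  proof -
    have "(f has_derivative f') (at (\<gamma> 0) within \<gamma> ` {0..1})"
      using has_derivative_subset[OF that assms(4)] assms(3) by simp
    then have "((f \<circ> \<gamma>) has_derivative (f' \<circ> (\<lambda>x. x *\<^sub>R v))) (at 0 within {0..1})"
      using assms(5) unfolding has_vector_derivative_def by (intro diff_chain_within)
    then show ?thesis
      using linear_scale[OF has_derivative_linear[OF that]]
      by (simp add: has_vector_derivative_def o_def)
  qed
  then show ?thesis
    using assms(1,2) vector_derivative_unique_within_closed_interval[of 0 1 0 "f \<circ> \<gamma>"]
    by auto
qed

text \<open>Linear maps that agree on velocities agree on their span. This is all the uniqueness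
  that survives for a thin set such as the bounding sphere.\<close>

lemma has_derivative_eq_on_tangent_space:
  fixes f :: "'a::real_normed_vector \<Rightarrow> 'b::real_normed_vector"
  assumes "(f has_derivative f1) (at p within M)" "(f has_derivative f2) (at p within M)"
    and "v \<in> tangent_space M p"
  shows "f1 v = f2 v"
  using assms(3) unfolding tangent_space_def
proof (rule linear_eq_on_span[rotated 3])
  show "linear f1" "linear f2"
    using assms(1,2) by (auto intro: has_derivative_linear)
qed (use has_derivative_eq_on_velocity[OF assms(1,2)] in blast)

text \<open>\<open>frechet_derivative\<close> is a choice among the derivatives within
  \<open>S\<close>. Both functions have the same candidates, so the choices coincide even where no
  derivative exists.\<close>

lemma frechet_derivative_cong:
  assumes "\<And>x. x \<in> S \<Longrightarrow> f x = g x" "x \<in> S"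
  shows "frechet_derivative f (at x within S) = frechet_derivative g (at x within S)"
proof -
  have "(f has_derivative f') (at x within S) \<longleftrightarrow> (g has_derivative f') (at x within S)" for f'
    using has_derivative_transform[of x S f g] has_derivative_transform[of x S g f] assms by auto
  then show ?thesis
    by (simp add: frechet_derivative_def)
qed

lemma differentiable_on_cong:
  assumes "\<And>x. x \<in> S \<Longrightarrow> f x = g x"
  shows "f differentiable_on S \<longleftrightarrow> g differentiable_on S"
  unfolding differentiable_on_def differentiable_def
  using has_derivative_transform[of _ S f g] has_derivative_transform[of _ S g f] assms
  by (metis (full_types))

lemma Ck_on_cong:
  assumes "\<And>x. x \<in> S \<Longrightarrow> f x = g x"
  shows "Ck_on m V S f \<longleftrightarrow> Ck_on m V S g"
  using assms
proof (induction m arbitrary: f g)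
  case 0
  then show ?case
    by (simp cong: continuous_on_cong)
next
  case (Suc m)
  have "Ck_on m V S (\<lambda>x. frechet_derivative f (at x within S) v) \<longleftrightarrow>
      Ck_on m V S (\<lambda>x. frechet_derivative g (at x within S) v)" for v
    by (rule Suc.IH) (use frechet_derivative_cong[of S f g] Suc.prems in metis)
  then show ?case
    using differentiable_on_cong[of S f g] Suc.prems by simp
qed

lemma Ck_on_SucD: "Ck_on (Suc m) V S f \<Longrightarrow> Ck_on m V S f"
proof (induction m arbitrary: f)
  case 0
  then show ?case
    by (simp add: differentiable_imp_continuous_on)
qed auto

lemma Ck_on_mono: "Ck_on m V S f \<Longrightarrow> l \<le> m \<Longrightarrow> Ck_on l V S f"
  by (induction m) (auto simp: le_Suc_eq dest: Ck_on_SucD simp del: Ck_on.simps)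

section \<open>Calculus up to the boundary on convex sets with nonempty interior\<close>

text \<open>These two properties of the disk are enough to make derivatives within \<open>D\<close>
  unique at every point of \<open>D\<close>, which turns \<open>frechet_derivative\<close> into a
  usable operator.\<close>

locale convex_body =
  fixes D :: "(real^'n) set"
  assumes convex: "convex D" and interior_nonempty: "interior D \<noteq> {}"
begin

text \<open>Segments from \<open>x\<close> to points of \<open>D\<close> make all vectors
  \<open>y - x\<close> velocities, and since \<open>D\<close> contains a ball these vectors span the
  space.\<close>

lemma derivative_unique:
  fixes f :: "real^'n \<Rightarrow> 'b::real_normed_vector"
  assumes x: "x \<in> D"
    and f1: "(f has_derivative f1) (at x within D)" and f2: "(f has_derivative f2) (at x within D)"
  shows "f1 = f2"
proof
  fix v :: "real^'n"
  have lin: "linear f1" "linear f2"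
    using f1 f2 by (auto intro: has_derivative_linear)
  have *: "f1 (y - x) = f2 (y - x)" if "y \<in> D" for y
  proof (rule has_derivative_eq_on_velocity[OF f1 f2])
    show "(\<lambda>t. x + t *\<^sub>R (y - x)) ` {0..1} \<subseteq> D"
    proof clarify
      fix t :: real
      assume "t \<in> {0..1}"
      then have "(1 - t) *\<^sub>R x + t *\<^sub>R y \<in> D"
        using convex x that by (intro convexD_alt) auto
      then show "x + t *\<^sub>R (y - x) \<in> D"
        by (simp add: algebra_simps)
    qed
    show "((\<lambda>t. x + t *\<^sub>R (y - x)) has_vector_derivative y - x) (at 0 within {0..1})"
      by (auto intro!: derivative_eq_intros)
  qed simp
  obtain c \<epsilon> where c: "0 < \<epsilon>" "cball c \<epsilon> \<subseteq> D"
    using interior_nonempty mem_interior_cball by blast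
  \<comment> \<open>The scaling keeps \<open>c + s *\<^sub>R v\<close> inside the ball around
    \<open>c\<close>; the added 1 covers \<open>v = 0\<close>.\<close>
  define s where "s = \<epsilon> / (norm v + 1)"
  have s: "0 < s" "s * norm v \<le> \<epsilon>"
    using c(1) by (auto simp: s_def divide_simps add_nonneg_pos algebra_simps add_pos_nonneg)
  have "c + s *\<^sub>R v \<in> D" "c \<in> D"
    using s c by (auto simp: dist_norm subset_iff)
  \<comment> \<open>The two arguments from \<open>x\<close> differ by \<open>s *\<^sub>R v\<close>,
    so linearity recovers an arbitrary direction.\<close>
  then have "f1 ((c + s *\<^sub>R v - x) - (c - x)) = f2 ((c + s *\<^sub>R v - x) - (c - x))"
    using * lin by (simp only: linear_diff)
  then show "f1 v = f2 v"
    using lin s(1) by (simp add: linear_scale)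
qed

lemma frechet_derivative_eq:
  fixes f :: "real^'n \<Rightarrow> 'b::real_normed_vector"
  assumes "x \<in> D" "(f has_derivative f') (at x within D)"
  shows "frechet_derivative f (at x within D) = f'"
  using derivative_unique[OF assms(1) _ assms(2)] assms(2) frechet_derivative_works
  by (metis differentiableI)

lemma Ck_on_linear:
  fixes f :: "real^'n \<Rightarrow> 'b::real_normed_vector"
  assumes "bounded_linear L" "Ck_on m UNIV D f"
  shows "Ck_on m UNIV D (\<lambda>x. L (f x))"
  using assms(2)
proof (induction m arbitrary: f)
  case 0
  then show ?case
    using assms(1) by (simp add: bounded_linear.continuous_on)
next
  case (Suc m)
  have der: "((\<lambda>x. L (f x)) has_derivative (\<lambda>v. L (frechet_derivative f (at x within D) v)))
      (at x within D)" if "x \<in> D" for x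
    using Suc.prems that frechet_derivative_works
    by (auto simp: differentiable_on_def intro!: bounded_linear.has_derivative[OF assms(1)])
  have "Ck_on m UNIV D (\<lambda>x. frechet_derivative (\<lambda>x. L (f x)) (at x within D) v)" for v
  proof (subst Ck_on_cong)
    show "frechet_derivative (\<lambda>x. L (f x)) (at x within D) v
        = L (frechet_derivative f (at x within D) v)" if "x \<in> D" for x
      using frechet_derivative_eq[OF that der[OF that]] by simp
    show "Ck_on m UNIV D (\<lambda>x. L (frechet_derivative f (at x within D) v))"
      using Suc by simp
  qed
  then show ?case
    using der by (auto simp: differentiable_on_def differentiable_def)
qed

lemma Ck_on_add:
  fixes f g :: "real^'n \<Rightarrow> 'b::real_normed_vector"
  assumes "Ck_on m UNIV D f" "Ck_on m UNIV D g"
  shows "Ck_on m UNIV D (\<lambda>x. f x + g x)"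
  using assms
proof (induction m arbitrary: f g)
  case 0
  then show ?case
    by (simp add: continuous_on_add)
next
  case (Suc m)
  let ?d = "\<lambda>f x. frechet_derivative f (at x within D)"
  have der: "((\<lambda>x. f x + g x) has_derivative (\<lambda>v. ?d f x v + ?d g x v)) (at x within D)"
    if "x \<in> D" for x
    using Suc.prems that frechet_derivative_works
    by (auto simp: differentiable_on_def intro!: has_derivative_add)
  have "Ck_on m UNIV D (\<lambda>x. ?d (\<lambda>x. f x + g x) x v)" for v
  proof (subst Ck_on_cong)
    show "?d (\<lambda>x. f x + g x) x v = ?d f x v + ?d g x v" if "x \<in> D" for x
      using frechet_derivative_eq[OF that der[OF that]] by simp
    show "Ck_on m UNIV D (\<lambda>x. ?d f x v + ?d g x v)"
      using Suc by simp
  qed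
  then show ?case
    using der by (auto simp: differentiable_on_def differentiable_def)
qed

lemma Ck_on_diff:
  fixes f g :: "real^'n \<Rightarrow> 'b::real_normed_vector"
  assumes "Ck_on m UNIV D f" "Ck_on m UNIV D g"
  shows "Ck_on m UNIV D (\<lambda>x. f x - g x)"
  using Ck_on_add[OF assms(1) Ck_on_linear[OF bounded_linear_minus[OF bounded_linear_ident] assms(2)]]
  by simp

lemma Ck_on_zero: "Ck_on m UNIV D (\<lambda>x. 0 :: 'b::real_normed_vector)"
proof (induction m)
  case (Suc m)
  have "frechet_derivative (\<lambda>x. 0 :: 'b) (at x within D) v = 0" if "x \<in> D" for x v
    by (simp add: frechet_derivative_eq[OF that has_derivative_const])
  then have "Ck_on m UNIV D (\<lambda>x. frechet_derivative (\<lambda>x. 0 :: 'b) (at x within D) v)" for v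
    using Suc by (subst Ck_on_cong[where g = "\<lambda>x. 0"]) auto
  then show ?case
    by (simp add: differentiable_on_const)
qed simp

lemma Ck_on_sum:
  fixes f :: "'i \<Rightarrow> real^'n \<Rightarrow> 'b::real_normed_vector"
  assumes "\<And>i. i \<in> A \<Longrightarrow> Ck_on m UNIV D (f i)"
  shows "Ck_on m UNIV D (\<lambda>x. \<Sum>i\<in>A. f i x)"
  using assms by (induction A rule: infinite_finite_induct) (auto intro: Ck_on_add Ck_on_zero)

lemma has_derivative_partials:
  assumes "f differentiable (at x within D)" "x \<in> D"
  shows "(f has_derivative (\<lambda>v. \<Sum>j\<in>UNIV. v $ j * partial_deriv D j f x)) (at x within D)"
proof -
  let ?f' = "frechet_derivative f (at x within D)"
  have der: "(f has_derivative ?f') (at x within D)"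
    using assms frechet_derivative_works by blast
  have "?f' v = (\<Sum>j\<in>UNIV. v $ j * partial_deriv D j f x)" for v
  proof -
    have "?f' v = ?f' (\<Sum>j\<in>UNIV. v $ j *\<^sub>R axis j 1)"
      by (simp add: basis_expansion scalar_mult_eq_scaleR[symmetric])
    also have "\<dots> = (\<Sum>j\<in>UNIV. v $ j * ?f' (axis j 1))"
      using has_derivative_linear[OF der] by (simp add: linear_sum linear_scale)
    finally show ?thesis
      by (simp add: partial_deriv_def)
  qed
  then have "?f' = (\<lambda>v. \<Sum>j\<in>UNIV. v $ j * partial_deriv D j f x)"
    by blast
  then show ?thesis
    using der by simp
qed

lemma partial_deriv_eq:
  assumes "x \<in> D" "(f has_derivative f') (at x within D)"
  shows "partial_deriv D j f x = f' (axis j 1)"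
  using frechet_derivative_eq[OF assms] by (simp add: partial_deriv_def)

lemma Ck_on_partial_deriv: "Ck_on (Suc m) UNIV D f \<Longrightarrow> Ck_on m UNIV D (partial_deriv D j f)"
  by (simp add: partial_deriv_def)

lemma Ck_on_iterated_partial:
  "Ck_on (m + length js) UNIV D f \<Longrightarrow> Ck_on m UNIV D (foldr (partial_deriv D) js f)"
proof (induction js arbitrary: m)
  case (Cons j js)
  show ?case
    unfolding foldr.simps o_apply
    by (rule Ck_on_partial_deriv, rule Cons.IH) (use Cons.prems in simp)
qed simp

text \<open>Equality on \<open>D\<close> suffices because every derivative is taken within
  \<open>D\<close>. With a one-element list this also serves to rewrite under a single
  \<open>partial_deriv\<close>.\<close>

lemma iterated_partial_cong:
  assumes "\<And>x. x \<in> D \<Longrightarrow> f x = g x" "x \<in> D"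
  shows "foldr (partial_deriv D) js f x = foldr (partial_deriv D) js g x"
  using assms(2)
proof (induction js arbitrary: x)
  case (Cons j js)
  then show ?case
    using frechet_derivative_cong[of D "foldr (partial_deriv D) js f" "foldr (partial_deriv D) js g"]
    unfolding foldr.simps o_apply partial_deriv_def[of D j] by metis
qed (use assms in simp)

lemma iterated_partial_diff:
  assumes "Ck_on (length js) UNIV D f" "Ck_on (length js) UNIV D g" "x \<in> D"
  shows "foldr (partial_deriv D) js (\<lambda>x. f x - g x) x
     = foldr (partial_deriv D) js f x - foldr (partial_deriv D) js g x"
  using assms
proof (induction js arbitrary: x)
  case (Cons j js)
  let ?F = "foldr (partial_deriv D) js f" and ?G = "foldr (partial_deriv D) js g"
  have "Ck_on 1 UNIV D ?F" "Ck_on 1 UNIV D ?G"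
    using Cons.prems by (auto intro!: Ck_on_iterated_partial simp del: Ck_on.simps)
  then have "?F differentiable (at x within D)" "?G differentiable (at x within D)"
    using Cons.prems(3) by (auto simp: differentiable_on_def)
  then have F: "(?F has_derivative frechet_derivative ?F (at x within D)) (at x within D)"
    and G: "(?G has_derivative frechet_derivative ?G (at x within D)) (at x within D)"
    by (simp_all only: frechet_derivative_works)
  have C: "Ck_on (length js) UNIV D f" "Ck_on (length js) UNIV D g"
    using Cons.prems Ck_on_SucD by (auto simp del: Ck_on.simps)
  have "partial_deriv D j (foldr (partial_deriv D) js (\<lambda>x. f x - g x)) x
      = partial_deriv D j (\<lambda>x. ?F x - ?G x) x"
    using iterated_partial_cong[of "foldr (partial_deriv D) js (\<lambda>x. f x - g x)" "\<lambda>x. ?F x - ?G x" x "[j]"]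
      Cons.IH[OF C] Cons.prems(3) by simp
  also have "\<dots> = partial_deriv D j ?F x - partial_deriv D j ?G x"
    using partial_deriv_eq[OF Cons.prems(3) has_derivative_diff[OF F G]]
    by (simp add: partial_deriv_def)
  finally show ?case
    by simp
qed simp

end

section \<open>Symmetry of mixed partial derivatives, boundary included\<close>

text \<open>Two applications of the mean value theorem, along \<open>u\<close> and then along
  \<open>w\<close>. The left-hand side is symmetric in \<open>u\<close> and \<open>w\<close>,
  whereas the right-hand side differentiates in a fixed order.\<close>

lemma second_difference:
  fixes f :: "'a::real_normed_vector \<Rightarrow> real"
  assumes f: "\<And>y. y \<in> ball x e \<Longrightarrow> (f has_derivative f' y) (at y)"
    and f': "\<And>y. y \<in> ball x e \<Longrightarrow> ((\<lambda>y. f' y u) has_derivative f'' y) (at y)"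
    and h: "0 < h" "h * (norm u + norm w) < e"
  obtains y where "dist x y \<le> h * (norm u + norm w)"
    and "f (x + h *\<^sub>R u + h *\<^sub>R w) - f (x + h *\<^sub>R u) - f (x + h *\<^sub>R w) + f x = h * h * f'' y w"
proof -
  have near: "dist x (x + s *\<^sub>R u + t *\<^sub>R w) \<le> h * (norm u + norm w)"
    if "0 \<le> s" "s \<le> h" "0 \<le> t" "t \<le> h" for s t
  proof -
    have "dist x (x + s *\<^sub>R u + t *\<^sub>R w) = norm (s *\<^sub>R u + t *\<^sub>R w)"
      by (subst dist_commute) (simp add: dist_norm add.assoc)
    also have "\<dots> \<le> s * norm u + t * norm w"
      using that by (intro order_trans[OF norm_triangle_ineq]) simp
    also have "\<dots> \<le> h * norm u + h * norm w"
      using that by (intro add_mono mult_right_mono) auto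
    finally show ?thesis
      by (simp add: algebra_simps)
  qed
  then have in_ball: "x + s *\<^sub>R u + t *\<^sub>R w \<in> ball x e"
    if "0 \<le> s" "s \<le> h" "0 \<le> t" "t \<le> h" for s t
    using near[OF that] h(2) by simp
  have line: "((\<lambda>s. g (a + s *\<^sub>R v)) has_real_derivative g' v) (at s)"
    if "(g has_derivative g') (at (a + s *\<^sub>R v))" for g :: "'a \<Rightarrow> real" and g' a s v
  proof -
    have "((\<lambda>s. a + s *\<^sub>R v) has_derivative (\<lambda>t. t *\<^sub>R v)) (at s)"
      by (auto intro!: derivative_eq_intros)
    then have "((\<lambda>s. g (a + s *\<^sub>R v)) has_derivative (\<lambda>t. g' (t *\<^sub>R v))) (at s)"
      using has_derivative_compose[of "\<lambda>s. a + s *\<^sub>R v" "\<lambda>t. t *\<^sub>R v" s UNIV g g'] that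
      by simp
    moreover have "(\<lambda>t. g' (t *\<^sub>R v)) = times (g' v)"
      using linear_scale[OF has_derivative_linear[OF that]] by (auto simp: fun_eq_iff)
    ultimately show ?thesis
      by (simp add: has_field_derivative_def)
  qed
  \<comment> \<open>The difference in direction \<open>w\<close>, as a function of the displacement
    along \<open>u\<close>. Its increment from 0 to \<open>h\<close> is the second
    difference.\<close>
  define \<phi> where "\<phi> s = f (x + h *\<^sub>R w + s *\<^sub>R u) - f (x + s *\<^sub>R u)" for s
  have "\<exists>s. 0 < s \<and> s < h \<and> \<phi> h - \<phi> 0 =
      (h - 0) * (f' (x + h *\<^sub>R w + s *\<^sub>R u) u - f' (x + s *\<^sub>R u) u)"
  proof (rule MVT2[OF h(1)])
    fix s
    assume "0 \<le> s" "s \<le> h"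
    then have "x + h *\<^sub>R w + s *\<^sub>R u \<in> ball x e" "x + s *\<^sub>R u \<in> ball x e"
      using in_ball[of s h] in_ball[of s 0] h(1) by (simp_all add: ac_simps del: mem_ball)
    then show "DERIV \<phi> s :> f' (x + h *\<^sub>R w + s *\<^sub>R u) u - f' (x + s *\<^sub>R u) u"
      unfolding \<phi>_def by (intro DERIV_diff line f)
  qed
  then obtain s where s: "0 < s" "s < h"
    and s_eq: "\<phi> h - \<phi> 0 = h * (f' (x + h *\<^sub>R w + s *\<^sub>R u) u - f' (x + s *\<^sub>R u) u)"
    by auto
  have "\<exists>t. 0 < t \<and> t < h \<and> f' (x + s *\<^sub>R u + h *\<^sub>R w) u - f' (x + s *\<^sub>R u + 0 *\<^sub>R w) u
      = (h - 0) * f'' (x + s *\<^sub>R u + t *\<^sub>R w) w"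
  proof (rule MVT2[OF h(1), where f = "\<lambda>t. f' (x + s *\<^sub>R u + t *\<^sub>R w) u"])
    fix t
    assume "0 \<le> t" "t \<le> h"
    then show "DERIV (\<lambda>t. f' (x + s *\<^sub>R u + t *\<^sub>R w) u) t :> f'' (x + s *\<^sub>R u + t *\<^sub>R w) w"
      using in_ball[of s t] s by (intro line[where g = "\<lambda>y. f' y u"] f') auto
  qed
  then obtain t where t: "0 < t" "t < h"
    and t_eq: "f' (x + s *\<^sub>R u + h *\<^sub>R w) u - f' (x + s *\<^sub>R u) u = h * f'' (x + s *\<^sub>R u + t *\<^sub>R w) w"
    by auto
  show thesis
  proof (rule that)
    show "dist x (x + s *\<^sub>R u + t *\<^sub>R w) \<le> h * (norm u + norm w)"
      using near s t by auto
    have "\<phi> h - \<phi> 0 = h * (h * f'' (x + s *\<^sub>R u + t *\<^sub>R w) w)"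
      unfolding t_eq[symmetric] s_eq by (simp add: algebra_simps)
    then show "f (x + h *\<^sub>R u + h *\<^sub>R w) - f (x + h *\<^sub>R u) - f (x + h *\<^sub>R w) + f x
        = h * h * f'' (x + s *\<^sub>R u + t *\<^sub>R w) w"
      by (simp add: \<phi>_def algebra_simps)
  qed
qed

text \<open>The same second difference, evaluated in both orders, equates \<open>fu\<close> and
  \<open>fw\<close> at two nearby points, in general different ones. Continuity then carries the
  equality to \<open>x\<close>.\<close>

lemma mixed_derivatives_eq:
  fixes f :: "'a::real_normed_vector \<Rightarrow> real"
  assumes "open U" "x \<in> U"
    and f: "\<And>y. y \<in> U \<Longrightarrow> (f has_derivative f' y) (at y)"
    and fu: "\<And>y. y \<in> U \<Longrightarrow> ((\<lambda>y. f' y u) has_derivative fu y) (at y)"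
    and fw: "\<And>y. y \<in> U \<Longrightarrow> ((\<lambda>y. f' y w) has_derivative fw y) (at y)"
    and cont: "continuous_on U (\<lambda>y. fu y w)" "continuous_on U (\<lambda>y. fw y u)"
  shows "fu x w = fw x u"
proof (rule ccontr)
  assume neq: "fu x w \<noteq> fw x u"
  define \<epsilon> where "\<epsilon> = \<bar>fu x w - fw x u\<bar> / 2"
  have "0 < \<epsilon>"
    using neq by (simp add: \<epsilon>_def)
  have "isCont (\<lambda>y. fu y w) x" "isCont (\<lambda>y. fw y u) x"
    using assms(1,2) cont continuous_on_eq_continuous_at by blast+
  then obtain d1 d2 where d: "0 < d1" "0 < d2"
    and d1: "\<And>y. dist y x < d1 \<Longrightarrow> dist (fu y w) (fu x w) < \<epsilon>"
    and d2: "\<And>y. dist y x < d2 \<Longrightarrow> dist (fw y u) (fw x u) < \<epsilon>"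
    using \<open>0 < \<epsilon>\<close> unfolding continuous_at_eps_delta by metis
  obtain e where e: "0 < e" "ball x e \<subseteq> U"
    using assms(1,2) openE by blast
  define b where "b = min e (min d1 d2)"
  \<comment> \<open>The added 1 makes \<open>h * (norm u + norm w) < b\<close> strict and avoids
    division by zero when both directions vanish.\<close>
  define h where "h = b / (norm u + norm w + 1)"
  have n: "0 < norm u + norm w + 1"
    by (simp add: add_nonneg_pos)
  have "0 < b"
    using e d by (simp add: b_def)
  then have h: "0 < h" "h * (norm u + norm w) < b"
    using n by (auto simp: h_def divide_simps add.assoc)
  have ball: "y \<in> ball x b \<Longrightarrow> y \<in> U" for y
    using e by (auto simp: b_def)
  obtain y where y: "dist x y \<le> h * (norm u + norm w)"
    "f (x + h *\<^sub>R u + h *\<^sub>R w) - f (x + h *\<^sub>R u) - f (x + h *\<^sub>R w) + f x = h * h * fu y w"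
    using second_difference[of x b f f' u fu h w] h f fu ball by blast
  obtain y' where y': "dist x y' \<le> h * (norm w + norm u)"
    "f (x + h *\<^sub>R w + h *\<^sub>R u) - f (x + h *\<^sub>R w) - f (x + h *\<^sub>R u) + f x = h * h * fw y' u"
    using second_difference[of x b f f' w fw h u] h f fw ball by (metis add.commute)
  have "h * h * fu y w = h * h * fw y' u"
    unfolding y(2)[symmetric] y'(2)[symmetric] by (simp add: algebra_simps)
  then have "fu y w = fw y' u"
    using h by simp
  moreover have "dist (fu y w) (fu x w) < \<epsilon>" "dist (fw y' u) (fw x u) < \<epsilon>"
    using d1[of y] d2[of y'] y(1) y'(1) h(2) by (auto simp: b_def dist_commute add.commute)
  ultimately show False
    by (simp add: \<epsilon>_def dist_real_def abs_if split: if_splits)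
qed

context convex_body
begin

text \<open>The theorem on mixed derivatives applies in the interior only. Both sides are continuous
  on \<open>D\<close>, and a convex set with nonempty interior lies in the closure of that
  interior.\<close>

lemma partial_deriv_commute:
  assumes f: "Ck_on 2 UNIV D f" and x: "x \<in> D"
  shows "partial_deriv D i (partial_deriv D j f) x = partial_deriv D j (partial_deriv D i f) x"
proof -
  let ?d = "\<lambda>f x. frechet_derivative f (at x within D)"
  let ?g = "\<lambda>x. partial_deriv D i (partial_deriv D j f) x - partial_deriv D j (partial_deriv D i f) x"
  have f': "Ck_on (Suc (Suc 0)) UNIV D f"
    using f by (simp add: numeral_2_eq_2)
  have cont: "continuous_on D (partial_deriv D i (partial_deriv D j f))" for i j
    using Ck_on_partial_deriv[OF Ck_on_partial_deriv[OF f']] by simp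
  have diff: "f differentiable_on D" "partial_deriv D i f differentiable_on D" for i
    using f' Ck_on_partial_deriv[OF f', of i] by simp_all
  have der: "(g has_derivative ?d g y) (at y)"
    if "y \<in> interior D" "g differentiable_on D" for g :: "real^'n \<Rightarrow> real" and y
  proof -
    have "y \<in> D"
      using that interior_subset by blast
    then have "g differentiable (at y within D)"
      using that by (simp add: differentiable_on_def)
    then show ?thesis
      unfolding at_within_interior[OF that(1)] frechet_derivative_works .
  qed
  have zero: "?g y = 0" if y: "y \<in> interior D" for y
  proof -
    have "?d (\<lambda>y. ?d f y (axis j 1)) y (axis i 1) = ?d (\<lambda>y. ?d f y (axis i 1)) y (axis j 1)"
    proof (rule mixed_derivatives_eq[of "interior D" y f "?d f"])
      show "(f has_derivative ?d f z) (at z)" if "z \<in> interior D" for z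
        using der[OF that diff(1)] .
      show "((\<lambda>y. ?d f y (axis j 1)) has_derivative ?d (\<lambda>y. ?d f y (axis j 1)) z) (at z)"
        "((\<lambda>y. ?d f y (axis i 1)) has_derivative ?d (\<lambda>y. ?d f y (axis i 1)) z) (at z)"
        if "z \<in> interior D" for z
        using der[OF that diff(2)] unfolding partial_deriv_def by simp_all
      show "continuous_on (interior D) (\<lambda>y. ?d (\<lambda>y. ?d f y (axis j 1)) y (axis i 1))"
        "continuous_on (interior D) (\<lambda>y. ?d (\<lambda>y. ?d f y (axis i 1)) y (axis j 1))"
        using cont[of i j] cont[of j i] interior_subset[of D] continuous_on_subset
        unfolding partial_deriv_def by blast+
    qed (use y in auto)
    then show ?thesis
      by (simp add: partial_deriv_def)
  qed
  have "x \<in> closure (interior D)"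
    using x convex_closure_interior[OF convex interior_nonempty] closure_subset by blast
  then obtain s where s: "\<And>n. s n \<in> interior D" "s \<longlonglongrightarrow> x"
    using closure_sequential by metis
  have "continuous_on D ?g"
    by (intro continuous_on_diff cont)
  then have "(\<lambda>n. ?g (s n)) \<longlonglongrightarrow> ?g x"
    using s interior_subset[of D] x
    by (intro continuous_on_tendsto_compose[of D ?g s x sequentially] always_eventually) auto
  moreover have "(\<lambda>n. ?g (s n)) \<longlonglongrightarrow> 0"
    using zero s(1) by simp
  ultimately have "?g x = 0"
    by (rule LIMSEQ_unique)
  then show ?thesis
    by simp
qed

text \<open>The direction \<open>k\<close> passes one entry of \<open>as\<close> at a time. The
  induction hypothesis holds on all of \<open>D\<close>, so it may be used under the outer
  derivative in direction \<open>a\<close>.\<close>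

lemma iterated_partial_move:
  assumes "Ck_on (length (as @ k # bs)) UNIV D f" "x \<in> D"
  shows "foldr (partial_deriv D) (as @ k # bs) f x = foldr (partial_deriv D) (k # as @ bs) f x"
  using assms
proof (induction as arbitrary: x)
  case (Cons a as)
  let ?P = "foldr (partial_deriv D)"
  have C: "Ck_on (length (as @ k # bs)) UNIV D f"
    by (rule Ck_on_mono[OF Cons.prems(1)]) simp
  have "Ck_on 2 UNIV D (?P (as @ bs) f)"
    by (rule Ck_on_iterated_partial, rule Ck_on_mono[OF Cons.prems(1)]) simp
  then have "partial_deriv D a (partial_deriv D k (?P (as @ bs) f)) x
      = partial_deriv D k (partial_deriv D a (?P (as @ bs) f)) x"
    by (rule partial_deriv_commute) (rule Cons.prems)
  moreover have "?P [a] (?P (as @ k # bs) f) x = ?P [a] (?P (k # as @ bs) f) x"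
    by (rule iterated_partial_cong[OF Cons.IH[OF C] Cons.prems(2)])
  ultimately show ?case
    by simp
qed simp

lemma iterated_partial_perm:
  assumes "mset js = mset ks" "Ck_on (length js) UNIV D f" "x \<in> D"
  shows "foldr (partial_deriv D) js f x = foldr (partial_deriv D) ks f x"
  using assms
proof (induction ks arbitrary: js x)
  case (Cons k ks)
  have "k \<in> set js"
    using mset_eq_setD[OF Cons.prems(1)] by simp
  then obtain as bs where js: "js = as @ k # bs"
    using split_list[of k js] by blast
  have m: "mset (as @ bs) = mset ks"
    using Cons.prems(1) by (simp add: js)
  have C: "Ck_on (length (as @ bs)) UNIV D f"
    by (rule Ck_on_mono[OF Cons.prems(2)]) (simp add: js)
  have "foldr (partial_deriv D) js f x = foldr (partial_deriv D) (k # as @ bs) f x"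
    unfolding js by (rule iterated_partial_move) (use Cons.prems js in auto)
  also have "\<dots> = foldr (partial_deriv D) [k] (foldr (partial_deriv D) (as @ bs) f) x"
    by simp
  also have "\<dots> = foldr (partial_deriv D) [k] (foldr (partial_deriv D) ks f) x"
    by (rule iterated_partial_cong[OF Cons.IH[OF m C] Cons.prems(3)])
  finally show ?case
    by simp
qed simp

end

section \<open>Partial derivatives indexed by multi-indices\<close>

text \<open>This guarantees that the choice in \<open>multi_partial\<close> does pick a list with
  the required multiplicities.\<close>

lemma ex_list_with_counts:
  fixes \<alpha> :: "'n::finite \<Rightarrow> nat"
  shows "\<exists>js. \<forall>j. count_list js j = \<alpha> j"
proof -
  obtain js where "mset js = Abs_multiset \<alpha>"
    using ex_mset by blast
  then have "count (mset js) = \<alpha>"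
    by (simp add: Abs_multiset_inverse)
  then show ?thesis
    by (auto simp: count_mset)
qed

lemma length_eq_mi_order:
  assumes "\<forall>j. count_list js j = \<alpha> j"
  shows "length js = mi_order \<alpha>"
  using sum_count_set[of js UNIV] assms by (simp add: mi_order_def)

lemma le_mi_order: "\<alpha> j \<le> mi_order \<alpha>"
  unfolding mi_order_def by (rule member_le_sum) auto

lemma mi_order_Suc_upd: "mi_order (\<alpha>(j := Suc (\<alpha> j))) = Suc (mi_order \<alpha>)"
proof -
  have "mi_order (\<alpha>(j := Suc (\<alpha> j))) = Suc (\<alpha> j) + (\<Sum>i\<in>UNIV - {j}. \<alpha> i)"
    unfolding mi_order_def by (subst sum.remove[of _ j]) (auto intro!: sum.cong)
  also have "\<dots> = Suc (mi_order \<alpha>)"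
    unfolding mi_order_def by (subst (2) sum.remove[of _ j]) auto
  finally show ?thesis .
qed

context convex_body
begin

text \<open>Removes the choice from \<open>multi_partial\<close>: lists with equal multiplicities
  are permutations of each other, and the derivatives commute.\<close>

lemma multi_partial_eq_iterated:
  assumes js: "\<forall>j. count_list js j = \<alpha> j" and "Ck_on (mi_order \<alpha>) UNIV D f" "x \<in> D"
  shows "multi_partial D \<alpha> f x = foldr (partial_deriv D) js f x"
proof -
  define ks where "ks = (SOME js. \<forall>j. count_list js j = \<alpha> j)"
  have ks: "\<forall>j. count_list ks j = \<alpha> j"
    unfolding ks_def by (rule someI_ex[OF ex_list_with_counts])
  then have "mset ks = mset js"
    using js by (auto intro!: multiset_eqI simp: count_mset)
  then show ?thesis
    using iterated_partial_perm[of ks js f x] length_eq_mi_order[OF ks] assms(2,3)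
    by (simp add: multi_partial_def ks_def)
qed

lemma Ck_on_multi_partial:
  assumes "Ck_on (m + mi_order \<alpha>) UNIV D f"
  shows "Ck_on m UNIV D (multi_partial D \<alpha> f)"
proof -
  obtain js where js: "\<forall>j. count_list js j = \<alpha> j"
    using ex_list_with_counts by blast
  have "Ck_on (mi_order \<alpha>) UNIV D f"
    by (rule Ck_on_mono[OF assms]) simp
  then have "multi_partial D \<alpha> f x = foldr (partial_deriv D) js f x" if "x \<in> D" for x
    using multi_partial_eq_iterated[OF js _ that] by simp
  moreover have "Ck_on m UNIV D (foldr (partial_deriv D) js f)"
    by (rule Ck_on_iterated_partial) (simp add: assms length_eq_mi_order[OF js])
  ultimately show ?thesis
    using Ck_on_cong[of D "multi_partial D \<alpha> f"] by blast
qed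

text \<open>The lists chosen for the two multi-indices are unrelated. Both sides are therefore
  rewritten along a list \<open>js\<close> for \<open>\<alpha>\<close> and its extension
  \<open>j # js\<close>.\<close>

lemma partial_deriv_multi_partial:
  assumes "Ck_on (Suc (mi_order \<alpha>)) UNIV D f" "x \<in> D"
  shows "partial_deriv D j (multi_partial D \<alpha> f) x = multi_partial D (\<alpha>(j := Suc (\<alpha> j))) f x"
proof -
  obtain js where js: "\<forall>j. count_list js j = \<alpha> j"
    using ex_list_with_counts by blast
  then have js': "\<forall>i. count_list (j # js) i = (\<alpha>(j := Suc (\<alpha> j))) i"
    by simp
  have "multi_partial D \<alpha> f y = foldr (partial_deriv D) js f y" if "y \<in> D" for y
    by (rule multi_partial_eq_iterated[OF js Ck_on_SucD[OF assms(1)] that])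
  then have "foldr (partial_deriv D) [j] (multi_partial D \<alpha> f) x
      = foldr (partial_deriv D) [j] (foldr (partial_deriv D) js f) x"
    by (rule iterated_partial_cong[OF _ assms(2)])
  also have "\<dots> = multi_partial D (\<alpha>(j := Suc (\<alpha> j))) f x"
    by (subst multi_partial_eq_iterated[OF js' _ assms(2)])
      (use assms(1) in \<open>simp_all add: mi_order_Suc_upd del: Ck_on.simps\<close>)
  finally show ?thesis
    by simp
qed

lemma multi_partial_diff:
  assumes "Ck_on (mi_order \<alpha>) UNIV D f" "Ck_on (mi_order \<alpha>) UNIV D g" "x \<in> D"
  shows "multi_partial D \<alpha> (\<lambda>x. f x - g x) x = multi_partial D \<alpha> f x - multi_partial D \<alpha> g x"
proof -
  obtain js where js: "\<forall>j. count_list js j = \<alpha> j"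
    using ex_list_with_counts by blast
  show ?thesis
    using iterated_partial_diff[of js f g x] assms
    by (simp add: multi_partial_eq_iterated[OF js] Ck_on_diff length_eq_mi_order[OF js])
qed

lemma has_derivative_multi_partial:
  assumes "Ck_on (Suc (mi_order \<alpha>)) UNIV D f" "x \<in> D"
  shows "(multi_partial D \<alpha> f has_derivative
    (\<lambda>v. \<Sum>j\<in>UNIV. v $ j * multi_partial D (\<alpha>(j := Suc (\<alpha> j))) f x)) (at x within D)"
proof -
  have "Ck_on (Suc 0) UNIV D (multi_partial D \<alpha> f)"
    by (rule Ck_on_multi_partial) (use assms in simp)
  then have "multi_partial D \<alpha> f differentiable (at x within D)"
    using assms(2) by (simp add: differentiable_on_def)
  then show ?thesis
    using has_derivative_partials[of "multi_partial D \<alpha> f" x] assms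
    by (simp add: partial_deriv_multi_partial del: Ck_on.simps)
qed

end

section \<open>Coordinates on jets and the derivative of the jet prolongation\<close>

definition jet_unit :: "'k \<times> ('n \<Rightarrow> nat) \<Rightarrow> ('n, 'k) jet" where
  "jet_unit p = Jet (\<lambda>q. if q = p then 1 else 0)"

lemma jet_coord_jet_unit [simp]: "jet_coord (jet_unit p) q = (if q = p then 1 else 0)"
  unfolding jet_unit_def by (subst Jet_inverse) (auto intro: finite_subset[of _ "{p}"])

lemma norm_jet_unit [simp]: "norm (jet_unit p) = 1"
proof -
  have "jet_unit p \<bullet> jet_unit p = (\<Sum>q\<in>{p}. jet_coord (jet_unit p) q * jet_coord (jet_unit p) q)"
    by (rule inner_jet_eq_sum) (auto split: if_splits)
  then show ?thesis
    by (simp add: norm_eq_sqrt_inner)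
qed

lemma jet_coord_sum: "jet_coord (sum f A) p = (\<Sum>a\<in>A. jet_coord (f a) p)"
  by (induction A rule: infinite_finite_induct) auto

lemma jet_space_eq_sum:
  fixes x :: "('n::finite, 'k::finite) jet"
  assumes "x \<in> jet_space r"
  shows "x = (\<Sum>p\<in>UNIV \<times> {\<alpha>. mi_order \<alpha> \<le> r}. jet_coord x p *\<^sub>R jet_unit p)"
proof (rule jet_eqI)
  fix q :: "'k \<times> ('n \<Rightarrow> nat)"
  let ?I = "UNIV \<times> {\<alpha> :: 'n \<Rightarrow> nat. mi_order \<alpha> \<le> r} :: ('k \<times> ('n \<Rightarrow> nat)) set"
  have "jet_coord (\<Sum>p\<in>?I. jet_coord x p *\<^sub>R jet_unit p) q
      = (\<Sum>p\<in>?I. if q = p then jet_coord x p else 0)"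
    unfolding jet_coord_sum by (rule sum.cong) auto
  also have "\<dots> = (if q \<in> ?I then jet_coord x q else 0)"
    by (rule sum.delta') (simp add: finite_mi_order_le)
  also have "\<dots> = jet_coord x q"
    using assms by (cases q) (auto simp: jet_space_def)
  finally show "jet_coord x q = jet_coord (\<Sum>p\<in>?I. jet_coord x p *\<^sub>R jet_unit p) q"
    by simp
qed

lemma norm_jet_space:
  fixes x :: "('n::finite, 'k::finite) jet"
  assumes "x \<in> jet_space r"
  shows "norm x = sqrt (\<Sum>i\<in>UNIV. \<Sum>\<alpha> | mi_order \<alpha> \<le> r. (jet_coord x (i, \<alpha>))\<^sup>2)"
proof -
  have "x \<bullet> x = (\<Sum>p\<in>UNIV \<times> {\<alpha>. mi_order \<alpha> \<le> r}. jet_coord x p * jet_coord x p)"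
    by (rule inner_jet_eq_sum)
      (use assms in \<open>auto simp: finite_mi_order_le jet_space_def intro!: leI\<close>)
  then show ?thesis
    by (simp add: norm_eq_sqrt_inner sum.cartesian_product power2_eq_square)
qed

lemma abs_jet_coord_le_norm:
  fixes x :: "('n::finite, 'k::finite) jet"
  shows "\<bar>jet_coord x p\<bar> \<le> norm x"
proof -
  \<comment> \<open>The index \<open>p\<close> is inserted because the coordinate of
    \<open>x\<close> at \<open>p\<close> may be zero.\<close>
  have "x \<bullet> jet_unit p = (\<Sum>q\<in>insert p {q. jet_coord x q \<noteq> 0}. jet_coord x q * jet_coord (jet_unit p) q)"
    by (rule inner_jet_eq_sum) (auto simp: finite_jet_supp)
  also have "\<dots> = jet_coord x p"
    by (subst sum.remove[of _ p]) (auto simp: finite_jet_supp intro!: sum.neutral)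
  finally show ?thesis
    using Cauchy_Schwarz_ineq2[of x "jet_unit p"] by simp
qed

lemma snd_jet_prolong_in_jet_space: "snd (jet_prolong r D f z) \<in> jet_space r"
  by (simp add: jet_space_def jet_coord_jet_prolong)

lemma fst_jet_prolong [simp]: "fst (jet_prolong r D f z) = z"
  by (simp add: jet_prolong_def)

lemma jet_prolong_eq_Pair: "jet_prolong r D f z = (z, snd (jet_prolong r D f z))"
  by (simp add: prod_eq_iff)

lemma C_space_component:
  assumes "convex_body D" "f \<in> C_space m D"
  shows "Ck_on m UNIV D (\<lambda>x. f x $ i)"
  using convex_body.Ck_on_linear[OF assms(1) bounded_linear_vec_nth[of i]] assms(2)
  by (simp add: C_space_def)

context convex_body
begin

lemma jet_prolong_diff:
  assumes "f \<in> C_space m D" "g \<in> C_space m D" "z \<in> D"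
  shows "snd (jet_prolong m D (\<lambda>x. f x - g x) z)
    = snd (jet_prolong m D f z) - snd (jet_prolong m D g z)"
proof (rule jet_eqI)
  fix p :: "'a \<times> ('n \<Rightarrow> nat)"
  obtain i \<alpha> where p: "p = (i, \<alpha>)"
    by fastforce
  have "Ck_on (mi_order \<alpha>) UNIV D (\<lambda>x. f x $ i)" "Ck_on (mi_order \<alpha>) UNIV D (\<lambda>x. g x $ i)"
    if "mi_order \<alpha> \<le> m"
    using that assms(1,2) C_space_component[OF convex_body_axioms] Ck_on_mono by blast+
  then show "jet_coord (snd (jet_prolong m D (\<lambda>x. f x - g x) z)) p
      = jet_coord (snd (jet_prolong m D f z) - snd (jet_prolong m D g z)) p"
    using multi_partial_diff[OF _ _ assms(3)] by (simp add: p jet_coord_jet_prolong)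
qed

text \<open>The map \<open>g\<close> enters the derivative only through coordinates of its jet of
  order \<open>Suc r\<close> at \<open>z\<close>. This explicit form lets two maps with equal jets
  share one derivative.\<close>

lemma has_derivative_jet_prolong:
  fixes g :: "real^'n \<Rightarrow> real^'k"
  assumes g: "g \<in> C_space (Suc r) D" and z: "z \<in> D"
  shows "(jet_prolong r D g has_derivative (\<lambda>v. (v, \<Sum>(i, \<alpha>)\<in>UNIV \<times> {\<alpha>. mi_order \<alpha> \<le> r}.
      (\<Sum>j\<in>UNIV. v $ j * jet_coord (snd (jet_prolong (Suc r) D g z)) (i, \<alpha>(j := Suc (\<alpha> j))))
        *\<^sub>R jet_unit (i, \<alpha>)))) (at z within D)"
proof -
  let ?I = "UNIV \<times> {\<alpha> :: 'n \<Rightarrow> nat. mi_order \<alpha> \<le> r} :: ('k \<times> ('n \<Rightarrow> nat)) set"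
  \<comment> \<open>As a finite sum of scalar functions times fixed unit jets, the prolongation can
    be differentiated term by term.\<close>
  have eq: "jet_prolong r D g
      = (\<lambda>x. (x, \<Sum>(i, \<alpha>)\<in>?I. multi_partial D \<alpha> (\<lambda>x. g x $ i) x *\<^sub>R jet_unit (i, \<alpha>)))"
  proof
    fix x
    have "snd (jet_prolong r D g x)
        = (\<Sum>p\<in>?I. jet_coord (snd (jet_prolong r D g x)) p *\<^sub>R jet_unit p)"
      by (rule jet_space_eq_sum[OF snd_jet_prolong_in_jet_space])
    also have "\<dots> = (\<Sum>(i, \<alpha>)\<in>?I. multi_partial D \<alpha> (\<lambda>x. g x $ i) x *\<^sub>R jet_unit (i, \<alpha>))"
      by (rule sum.cong) (auto simp: jet_coord_jet_prolong)
    finally show "jet_prolong r D g x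
        = (x, \<Sum>(i, \<alpha>)\<in>?I. multi_partial D \<alpha> (\<lambda>x. g x $ i) x *\<^sub>R jet_unit (i, \<alpha>))"
      using jet_prolong_eq_Pair[of r D g x] by simp
  qed
  have "((\<lambda>x. case p of (i, \<alpha>) \<Rightarrow> multi_partial D \<alpha> (\<lambda>x. g x $ i) x *\<^sub>R jet_unit (i, \<alpha>)) has_derivative
      (\<lambda>v. case p of (i, \<alpha>) \<Rightarrow>
        (\<Sum>j\<in>UNIV. v $ j * jet_coord (snd (jet_prolong (Suc r) D g z)) (i, \<alpha>(j := Suc (\<alpha> j))))
          *\<^sub>R jet_unit (i, \<alpha>))) (at z within D)" if I: "p \<in> ?I" for p
  proof -
    obtain i \<alpha> where p: "p = (i, \<alpha>)" "mi_order \<alpha> \<le> r"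
      using I by auto
    have "Ck_on (Suc (mi_order \<alpha>)) UNIV D (\<lambda>x. g x $ i)"
      by (rule Ck_on_mono[OF C_space_component[OF convex_body_axioms g]]) (use p in simp)
    from has_derivative_multi_partial[OF this z] show ?thesis
      using p by (auto simp: jet_coord_jet_prolong mi_order_Suc_upd intro!: has_derivative_scaleR_left)
  qed
  then show ?thesis
    unfolding eq by (intro has_derivative_Pair has_derivative_ident has_derivative_sum)
qed

end

section \<open>Transversality at a point depends only on the jet there\<close>

text \<open>The derivatives selected by \<open>frechet_derivative\<close> may differ from
  \<open>A\<close> and from each other, but all agree on \<open>tangent_space M z\<close>, the only
  place where transversality evaluates them.\<close>

lemma transverse_at_cong:
  assumes "(F has_derivative A) (at z within M)" "(G has_derivative A) (at z within M)" "F z = G z"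
  shows "transverse_at V F M S z \<longleftrightarrow> transverse_at V G M S z"
proof -
  have "frechet_derivative F (at z within M) v = A v"
    if "(F has_derivative A) (at z within M)" "v \<in> tangent_space M z" for F v
    using that(1) frechet_derivative_works[of F "at z within M"] that
    by (intro has_derivative_eq_on_tangent_space[of F _ z M A v]) (auto simp: differentiable_def)
  then have "frechet_derivative F (at z within M) v = frechet_derivative G (at z within M) v"
    if "v \<in> tangent_space M z" for v
    using assms that by simp
  then have "{frechet_derivative F (at z within M) v + w | v w.
        v \<in> tangent_space M z \<and> w \<in> tangent_space S (F z)}
      = {frechet_derivative G (at z within M) v + w | v w.
        v \<in> tangent_space M z \<and> w \<in> tangent_space S (G z)}"
    using assms(3) by (intro Collect_cong) metis
  then show ?thesis
    using assms(3) by (simp add: transverse_at_def)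
qed

text \<open>A common derivative within \<open>D\<close> restricts to one within
  \<open>frontier D\<close>, which lies in \<open>D\<close> because \<open>D\<close> is closed. The
  same \<open>A\<close> thus serves both transversality conditions.\<close>

lemma jet_transverse_at_cong:
  assumes D: "convex_body D" "closed D" and z: "z \<in> D"
    and gh: "g \<in> C_space (Suc r) D" "h \<in> C_space (Suc r) D"
    and eq: "jet_prolong (Suc r) D g z = jet_prolong (Suc r) D h z"
  shows "jet_transverse_at r D \<S> g z \<longleftrightarrow> jet_transverse_at r D \<S> h z"
proof -
  let ?J = "jet_prolong r D"
  obtain A where A: "(?J g has_derivative A) (at z within D)" "(?J h has_derivative A) (at z within D)"
    using convex_body.has_derivative_jet_prolong[OF D(1) gh(1) z]
      convex_body.has_derivative_jet_prolong[OF D(1) gh(2) z] eq by simp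
  \<comment> \<open>The lower jet is a truncation of the higher one, so the values at
    \<open>z\<close> agree as well.\<close>
  have "jet_coord (snd (?J g z)) (i, \<alpha>) = jet_coord (snd (?J h z)) (i, \<alpha>)" for i \<alpha>
    using arg_cong[OF eq, of "\<lambda>x. jet_coord (snd x) (i, \<alpha>)"]
    by (auto simp: jet_coord_jet_prolong split: if_splits)
  then have J: "?J g z = ?J h z"
    by (auto simp: prod_eq_iff intro!: jet_eqI)
  have "frontier D \<subseteq> D"
    using D(2) by (simp add: frontier_subset_eq)
  then have "transverse_at V (?J g) M S z \<longleftrightarrow> transverse_at V (?J h) M S z"
    if "M = D \<or> M = frontier D" for V M S
    using that has_derivative_subset[OF A(1)] has_derivative_subset[OF A(2)] A J
    by (intro transverse_at_cong[of _ A]) auto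
  then show ?thesis
    by (simp add: jet_transverse_at_def)
qed

section \<open>Jet norms and bounded maps with a prescribed jet\<close>

lemma C_norm_eq:
  "C_norm l D f = (SUP z\<in>D. ennreal (norm (snd (jet_prolong l D f z))))"
  unfolding C_norm_def norm_jet_space[OF snd_jet_prolong_in_jet_space]
  by (simp add: jet_coord_jet_prolong)

lemma norm_jet_le:
  fixes x :: "('n::finite, 'k::finite) jet"
  assumes "x \<in> jet_space r" "\<And>i \<alpha>. mi_order \<alpha> \<le> r \<Longrightarrow> \<bar>jet_coord x (i, \<alpha>)\<bar> \<le> B"
  shows "norm x \<le> real (CARD('k) * card {\<alpha> :: 'n \<Rightarrow> nat. mi_order \<alpha> \<le> r}) * B"
proof -
  let ?I = "UNIV \<times> {\<alpha> :: 'n \<Rightarrow> nat. mi_order \<alpha> \<le> r} :: ('k \<times> ('n \<Rightarrow> nat)) set"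

  have "norm x \<le> (\<Sum>p\<in>?I. norm (jet_coord x p *\<^sub>R jet_unit p :: ('n, 'k) jet))"
    by (subst jet_space_eq_sum[OF assms(1)]) (rule norm_sum)
  also have "\<dots> \<le> (\<Sum>p\<in>?I. B)"
    by (rule sum_mono) (auto simp: assms(2))
  finally show ?thesis
    by (simp add: card_cartesian_product)
qed

context convex_body
begin

text \<open>A several-variable analogue of the derivative sequences above: each derivative of a
  member is a combination of other members, so differentiation never leaves the family and the
  induction on \<open>m\<close> closes.\<close>

lemma Ck_on_chain:
  fixes P :: "('n \<Rightarrow> nat) \<Rightarrow> real^'n \<Rightarrow> 'b::real_normed_vector"
  assumes P: "\<And>\<beta> x. x \<in> D \<Longrightarrow> (P \<beta> has_derivative
      (\<lambda>v. \<Sum>j\<in>UNIV. v $ j *\<^sub>R P (\<beta>(j := Suc (\<beta> j))) x)) (at x within D)"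
  shows "Ck_on m UNIV D (P \<beta>)"
proof (induction m arbitrary: \<beta>)
  case 0
  then show ?case
    using P has_derivative_continuous by (fastforce simp: continuous_on_eq_continuous_within)
next
  case (Suc m)
  have "Ck_on m UNIV D (\<lambda>x. frechet_derivative (P \<beta>) (at x within D) v)" for v
  proof (subst Ck_on_cong)
    show "frechet_derivative (P \<beta>) (at x within D) v
        = (\<Sum>j\<in>UNIV. v $ j *\<^sub>R P (\<beta>(j := Suc (\<beta> j))) x)" if "x \<in> D" for x
      using frechet_derivative_eq[OF that P[OF that]] by simp
    show "Ck_on m UNIV D (\<lambda>x. \<Sum>j\<in>UNIV. v $ j *\<^sub>R P (\<beta>(j := Suc (\<beta> j))) x)"
      by (intro Ck_on_sum Ck_on_linear[OF bounded_linear_scaleR_right] Suc.IH)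
  qed
  then show ?case
    using P by (auto simp: differentiable_on_def differentiable_def)
qed

text \<open>Differentiating along a list raises the multi-index once per entry, so starting from
  index 0 one arrives at \<open>P (count_list js)\<close>.\<close>

lemma multi_partial_chain:
  fixes P :: "('n \<Rightarrow> nat) \<Rightarrow> real^'n \<Rightarrow> real"
  assumes P: "\<And>\<beta> x. x \<in> D \<Longrightarrow> (P \<beta> has_derivative
      (\<lambda>v. \<Sum>j\<in>UNIV. v $ j *\<^sub>R P (\<beta>(j := Suc (\<beta> j))) x)) (at x within D)"
    and "x \<in> D"
  shows "multi_partial D \<beta> (P (\<lambda>_. 0)) x = P \<beta> x"
proof -
  have iter: "foldr (partial_deriv D) js (P (\<lambda>_. 0)) x = P (count_list js) x" if "x \<in> D" for js x
    using that
  proof (induction js arbitrary: x)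
    case (Cons k js)
    have "foldr (partial_deriv D) [k] (foldr (partial_deriv D) js (P (\<lambda>_. 0))) x
        = foldr (partial_deriv D) [k] (P (count_list js)) x"
      by (rule iterated_partial_cong[OF Cons.IH Cons.prems])
    also have "\<dots> = (\<Sum>j\<in>UNIV. axis k 1 $ j * P ((count_list js)(j := Suc (count_list js j))) x)"
      using partial_deriv_eq[OF Cons.prems P[OF Cons.prems]] by simp
    also have "\<dots> = (\<Sum>j\<in>UNIV. if k = j then P ((count_list js)(j := Suc (count_list js j))) x else 0)"
      by (rule sum.cong) (auto simp: axis_def)
    also have "\<dots> = P ((count_list js)(k := Suc (count_list js k))) x"
      by simp
    also have "(count_list js)(k := Suc (count_list js k)) = count_list (k # js)"
      by auto
    finally show ?case
      by simp
  next
    case Nil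
    have "count_list [] = (\<lambda>_ :: 'n. 0)"
      by auto
    then show ?case
      by simp
  qed
  obtain js where js: "\<forall>j. count_list js j = \<beta> j"
    using ex_list_with_counts by blast
  have "count_list js = \<beta>"
    using js by blast
  then show ?thesis
    using multi_partial_eq_iterated[OF js Ck_on_chain[of P, OF P] assms(2)] iter[OF assms(2)] by simp
qed

end

text \<open>Products of one-variable dual functions, recentred at \<open>z\<close>, are dual to the
  partial derivatives of order at most \<open>N\<close> at \<open>z\<close>. A combination with the
  coordinates of \<open>a\<close> as coefficients has jet \<open>a\<close>.\<close>

lemma ex_bounded_map_with_jet:
  obtains C :: real where "0 < C"
    and "\<And>D z (a :: ('n::finite, 'k::finite) jet). convex_body D \<Longrightarrow> z \<in> D \<Longrightarrow> a \<in> jet_space N \<Longrightarrow>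
      \<exists>p :: real^'n \<Rightarrow> real^'k. p \<in> C_space N D \<and> snd (jet_prolong N D p z) = a \<and>
        C_norm N D p \<le> ennreal (C * norm a)"
proof -
  obtain d :: "nat \<Rightarrow> nat \<Rightarrow> real \<Rightarrow> real" and K :: real
    where d: "\<And>m l t. m \<le> N \<Longrightarrow> (d m l has_real_derivative d m (Suc l) t) (at t)"
      and d0: "\<And>m l. m \<le> N \<Longrightarrow> l \<le> N \<Longrightarrow> d m l 0 = (if l = m then 1 else 0)"
      and K: "\<And>m l t. m \<le> N \<Longrightarrow> l \<le> N \<Longrightarrow> \<bar>d m l t\<bar> \<le> K" "0 < K"
    using ex_bounded_chains_dual[of N] by blast
  define A where "A = {\<alpha> :: 'n \<Rightarrow> nat. mi_order \<alpha> \<le> N}"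
  have A: "finite A" "\<alpha> \<in> A \<Longrightarrow> \<alpha> j \<le> N" for \<alpha> j
    using le_mi_order[of \<alpha> j] by (auto simp: A_def finite_mi_order_le)
  have "(\<lambda>_. 0) \<in> A"
    by (simp add: A_def mi_order_def)
  then have "0 < card A"
    using A(1) card_gt_0_iff by blast
  \<comment> \<open>From the outside in: the number of jet coordinates, the number of summands in
    one coordinate of \<open>P\<close>, and the bound for a product with one factor for each
    variable. All of it is fixed before \<open>D\<close> and \<open>z\<close>.\<close>
  define C where "C = real (CARD('k) * card A) * (real (card A) * K ^ CARD('n))"
  have "0 < C"
    using \<open>0 < card A\<close> K(2) by (simp add: C_def)
  moreover have "\<exists>p :: real^'n \<Rightarrow> real^'k. p \<in> C_space N D \<and> snd (jet_prolong N D p z) = a \<and>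
        C_norm N D p \<le> ennreal (C * norm a)"
    if D: "convex_body D" and z: "z \<in> D" and a: "a \<in> jet_space N"
    for D z and a :: "('n, 'k) jet"
  proof -
    interpret convex_body D
      by (rule D)
    \<comment> \<open>\<open>\<Phi> \<alpha> \<beta>\<close> is the derivative of index
      \<open>\<beta>\<close> of the basis function for \<open>\<alpha>\<close>. The index
      \<open>\<beta>\<close> is unrestricted, since a derivative chain must continue beyond order
      \<open>N\<close>.\<close>
    define \<Phi> where "\<Phi> \<alpha> \<beta> x = (\<Prod>j\<in>UNIV. d (\<alpha> j) (\<beta> j) (x $ j - z $ j))"
      for \<alpha> \<beta> and x :: "real^'n"
    define P where "P \<beta> x = (\<Sum>i\<in>UNIV. \<Sum>\<alpha>\<in>A. \<Phi> \<alpha> \<beta> x *\<^sub>R axis i (jet_coord a (i, \<alpha>)))"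
      for \<beta> and x :: "real^'n"
    have d\<Phi>: "(\<Phi> \<alpha> \<beta> has_derivative (\<lambda>v. \<Sum>j\<in>UNIV. v $ j * \<Phi> \<alpha> (\<beta>(j := Suc (\<beta> j))) x)) (at x within D)"
      if "\<alpha> \<in> A" for \<alpha> \<beta> x
    proof -
      have "((\<lambda>x. d (\<alpha> j) (\<beta> j) (x $ j - z $ j)) has_derivative
          (\<lambda>v. d (\<alpha> j) (Suc (\<beta> j)) (x $ j - z $ j) * v $ j)) (at x within D)" for j
      proof -
        have "((\<lambda>x. x $ j - z $ j) has_derivative (\<lambda>v. v $ j)) (at x within D)"
          by (auto intro!: derivative_eq_intros bounded_linear.has_derivative[OF bounded_linear_vec_nth])
        from has_derivative_compose[OF this] show ?thesis
          using d[OF A(2)[OF that]] unfolding has_field_derivative_def by blast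
      qed
      then have "(\<Phi> \<alpha> \<beta> has_derivative (\<lambda>v. \<Sum>j\<in>UNIV. (d (\<alpha> j) (Suc (\<beta> j)) (x $ j - z $ j) * v $ j)
          * (\<Prod>i\<in>UNIV - {j}. d (\<alpha> i) (\<beta> i) (x $ i - z $ i)))) (at x within D)"
        unfolding \<Phi>_def by (rule has_derivative_prod)
      \<comment> \<open>Raising \<open>\<beta>\<close> at \<open>j\<close> changes only the factor
        for the variable \<open>j\<close>, which matches the product rule term by term.\<close>
      moreover have "\<Phi> \<alpha> (\<beta>(j := Suc (\<beta> j))) x = d (\<alpha> j) (Suc (\<beta> j)) (x $ j - z $ j)
          * (\<Prod>i\<in>UNIV - {j}. d (\<alpha> i) (\<beta> i) (x $ i - z $ i))" for j
        unfolding \<Phi>_def by (subst prod.remove[of _ j]) (auto intro!: prod.cong)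
      ultimately show ?thesis
        by (simp add: mult_ac)
    qed
    have dP: "(P \<beta> has_derivative (\<lambda>v. \<Sum>j\<in>UNIV. v $ j *\<^sub>R P (\<beta>(j := Suc (\<beta> j))) x)) (at x within D)"
      for \<beta> x
    proof -
      have "(P \<beta> has_derivative (\<lambda>v. \<Sum>i\<in>UNIV. \<Sum>\<alpha>\<in>A.
          (\<Sum>j\<in>UNIV. v $ j * \<Phi> \<alpha> (\<beta>(j := Suc (\<beta> j))) x) *\<^sub>R axis i (jet_coord a (i, \<alpha>)))) (at x within D)"
        unfolding P_def by (intro has_derivative_sum has_derivative_scaleR_left d\<Phi>)
      also have "(\<lambda>v. \<Sum>i\<in>UNIV. \<Sum>\<alpha>\<in>A.
          (\<Sum>j\<in>UNIV. v $ j * \<Phi> \<alpha> (\<beta>(j := Suc (\<beta> j))) x) *\<^sub>R axis i (jet_coord a (i, \<alpha>)))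
          = (\<lambda>v. \<Sum>j\<in>UNIV. v $ j *\<^sub>R P (\<beta>(j := Suc (\<beta> j))) x)"
      proof
        fix v :: "real^'n"
        have "(\<Sum>i\<in>UNIV. \<Sum>\<alpha>\<in>A.
            (\<Sum>j\<in>UNIV. v $ j * \<Phi> \<alpha> (\<beta>(j := Suc (\<beta> j))) x) *\<^sub>R axis i (jet_coord a (i, \<alpha>)))
          = (\<Sum>i\<in>UNIV. \<Sum>j\<in>UNIV. \<Sum>\<alpha>\<in>A.
            (v $ j * \<Phi> \<alpha> (\<beta>(j := Suc (\<beta> j))) x) *\<^sub>R axis i (jet_coord a (i, \<alpha>)))"
          unfolding scaleR_sum_left by (rule sum.cong[OF refl sum.swap])
        also have "\<dots> = (\<Sum>j\<in>UNIV. \<Sum>i\<in>UNIV. \<Sum>\<alpha>\<in>A.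
            (v $ j * \<Phi> \<alpha> (\<beta>(j := Suc (\<beta> j))) x) *\<^sub>R axis i (jet_coord a (i, \<alpha>)))"
          by (rule sum.swap)
        also have "\<dots> = (\<Sum>j\<in>UNIV. v $ j *\<^sub>R P (\<beta>(j := Suc (\<beta> j))) x)"
          by (simp add: P_def scaleR_sum_right)
        finally show "(\<Sum>i\<in>UNIV. \<Sum>\<alpha>\<in>A.
            (\<Sum>j\<in>UNIV. v $ j * \<Phi> \<alpha> (\<beta>(j := Suc (\<beta> j))) x) *\<^sub>R axis i (jet_coord a (i, \<alpha>)))
          = (\<Sum>j\<in>UNIV. v $ j *\<^sub>R P (\<beta>(j := Suc (\<beta> j))) x)" .
      qed
      finally show ?thesis .
    qed
    have P_nth: "P \<beta> x $ i = (\<Sum>\<alpha>\<in>A. \<Phi> \<alpha> \<beta> x * jet_coord a (i, \<alpha>))" for \<beta> x i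
    proof -
      have "P \<beta> x $ i = (\<Sum>k\<in>UNIV. if i = k then \<Sum>\<alpha>\<in>A. \<Phi> \<alpha> \<beta> x * jet_coord a (k, \<alpha>) else 0)"
        unfolding P_def sum_component by (rule sum.cong) (auto simp: axis_def)
      then show ?thesis
        by simp
    qed
    have dP_nth: "((\<lambda>x. P \<beta> x $ i) has_derivative
        (\<lambda>v. \<Sum>j\<in>UNIV. v $ j *\<^sub>R (P (\<beta>(j := Suc (\<beta> j))) x $ i))) (at x within D)" for \<beta> x i
      using bounded_linear.has_derivative[OF bounded_linear_vec_nth[of i] dP[of \<beta> x]] by simp
    have jet: "jet_coord (snd (jet_prolong N D (P (\<lambda>_. 0)) x)) (i, \<beta>) = (if \<beta> \<in> A then P \<beta> x $ i else 0)"
      if "x \<in> D" for x i \<beta>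
      using multi_partial_chain[of "\<lambda>\<beta> x. P \<beta> x $ i", OF dP_nth that]
      by (simp add: jet_coord_jet_prolong A_def)
    have "P (\<lambda>_. 0) \<in> C_space N D"
      unfolding C_space_def using Ck_on_chain[of P, OF dP] by simp
    moreover have "snd (jet_prolong N D (P (\<lambda>_. 0)) z) = a"
    proof (rule jet_eqI)
      fix q :: "'k \<times> ('n \<Rightarrow> nat)"
      obtain i \<beta> where q: "q = (i, \<beta>)"
        by fastforce
      show "jet_coord (snd (jet_prolong N D (P (\<lambda>_. 0)) z)) q = jet_coord a q"
      proof (cases "\<beta> \<in> A")
        case True
        \<comment> \<open>Each factor is evaluated at 0, where duality applies because the entries
          of \<open>\<alpha>\<close> and \<open>\<beta>\<close> are at most \<open>N\<close>. The
          product is 1 exactly when all entries agree.\<close>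
        have "\<Phi> \<alpha> \<beta> z = (if \<beta> = \<alpha> then 1 else 0)" if "\<alpha> \<in> A" for \<alpha>
        proof -
          have "\<Phi> \<alpha> \<beta> z = (\<Prod>j\<in>UNIV. if \<beta> j = \<alpha> j then 1 else 0)"
            unfolding \<Phi>_def using d0 A(2)[OF that] A(2)[OF True] by (intro prod.cong) auto
          then show ?thesis
            by (auto simp: fun_eq_iff)
        qed
        then have "P \<beta> z $ i = (\<Sum>\<alpha>\<in>A. if \<beta> = \<alpha> then jet_coord a (i, \<alpha>) else 0)"
          unfolding P_nth by (intro sum.cong) auto
        then show ?thesis
          using True A(1) by (simp add: q jet[OF z])
      next
        case False
        then show ?thesis
          using a by (auto simp: q jet[OF z] jet_space_def A_def)
      qed
    qed
    moreover have "C_norm N D (P (\<lambda>_. 0)) \<le> ennreal (C * norm a)"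
      unfolding C_norm_eq
    proof (intro SUP_least ennreal_leI)
      fix x
      assume x: "x \<in> D"
      have "norm (snd (jet_prolong N D (P (\<lambda>_. 0)) x))
          \<le> real (CARD('k) * card {\<alpha> :: 'n \<Rightarrow> nat. mi_order \<alpha> \<le> N})
            * (real (card A) * (K ^ CARD('n) * norm a))"
      proof (rule norm_jet_le[OF snd_jet_prolong_in_jet_space])
        fix i and \<beta> :: "'n \<Rightarrow> nat"
        assume "mi_order \<beta> \<le> N"
        then have \<beta>: "\<beta> \<in> A"
          by (simp add: A_def)
        have "\<bar>\<Phi> \<alpha> \<beta> x\<bar> \<le> K ^ CARD('n)" if "\<alpha> \<in> A" for \<alpha>
        proof -
          have "\<bar>\<Phi> \<alpha> \<beta> x\<bar> \<le> (\<Prod>j\<in>(UNIV :: 'n set). K)"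
            unfolding \<Phi>_def abs_prod
            by (rule prod_mono) (use K A(2)[OF that] A(2)[OF \<beta>] in auto)
          then show ?thesis
            by simp
        qed
        then have "\<bar>\<Phi> \<alpha> \<beta> x * jet_coord a (i, \<alpha>)\<bar> \<le> K ^ CARD('n) * norm a" if "\<alpha> \<in> A" for \<alpha>
          unfolding abs_mult using that K(2) by (intro mult_mono abs_jet_coord_le_norm) auto
        then have "\<bar>P \<beta> x $ i\<bar> \<le> (\<Sum>\<alpha>\<in>A. K ^ CARD('n) * norm a)"
          unfolding P_nth by (intro order_trans[OF sum_abs sum_mono])
        then show "\<bar>jet_coord (snd (jet_prolong N D (P (\<lambda>_. 0)) x)) (i, \<beta>)\<bar>
            \<le> real (card A) * (K ^ CARD('n) * norm a)"
          using \<beta> by (simp add: jet[OF x])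
      qed
      then show "norm (snd (jet_prolong N D (P (\<lambda>_. 0)) x)) \<le> C * norm a"
        by (simp add: C_def A_def mult.assoc)
    qed
    ultimately show ?thesis
      by blast
  qed
  ultimately show thesis
    using that by blast
qed

section \<open>Comparison of the two distances\<close>

lemma dist_jet_prolong:
  "dist (jet_prolong m D f z) (jet_prolong m D g z)
    = norm (snd (jet_prolong m D f z) - snd (jet_prolong m D g z))"
  by (simp add: dist_prod_def dist_norm)

theorem proposition14:
  fixes r :: nat
  shows "\<exists>C::real. 0 < C \<and>
    (\<forall>c \<rho> D (W :: ((real^'n) \<times> ('n::finite, 'k::finite) jet) set) \<S> (f :: real^'n \<Rightarrow> real^'k).
       0 < \<rho> \<and> D = cball c \<rho> \<and>
       W \<subseteq> jet_bundle r D \<and> closedin (top_of_set (jet_bundle r D)) W \<and>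
       semialgebraic (jet_bundle r UNIV) W \<and>
       whitney_stratification (jet_bundle r UNIV) (jet_bundle r (frontier D)) \<S> W \<and>
       f \<in> C_space (r + 1) D \<longrightarrow>
       delta r D \<S> f \<le> C_dist_set (r + 1) D f (non_transverse_maps r D \<S>) \<and>
       C_dist_set (r + 1) D f (non_transverse_maps r D \<S>) \<le> ennreal C * delta r D \<S> f)"
proof -
  obtain C :: real where C: "0 < C"
    and bump: "\<And>D z (a :: ('n, 'k) jet). convex_body D \<Longrightarrow> z \<in> D \<Longrightarrow> a \<in> jet_space (r + 1) \<Longrightarrow>
      \<exists>p :: real^'n \<Rightarrow> real^'k. p \<in> C_space (r + 1) D \<and> snd (jet_prolong (r + 1) D p z) = a \<and>
        C_norm (r + 1) D p \<le> ennreal (C * norm a)"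
    using ex_bounded_map_with_jet[of "r + 1"] by blast
  have "delta r D \<S> f \<le> C_dist_set (r + 1) D f (non_transverse_maps r D \<S>)"
    and "C_dist_set (r + 1) D f (non_transverse_maps r D \<S>) \<le> ennreal C * delta r D \<S> f"
    if "0 < \<rho>" and D_eq: "D = cball c \<rho>" and f: "f \<in> C_space (r + 1) D"
    for c \<rho> D \<S> and f :: "real^'n \<Rightarrow> real^'k"
  proof -
    interpret convex_body D
      using \<open>0 < \<rho>\<close> by unfold_locales (simp_all add: D_eq)
    let ?J = "jet_prolong (r + 1) D"
    show "delta r D \<S> f \<le> C_dist_set (r + 1) D f (non_transverse_maps r D \<S>)"
      unfolding C_dist_set_def
    proof (rule INF_greatest)
      fix g
      assume "g \<in> non_transverse_maps r D \<S>"
      then obtain z where g: "g \<in> C_space (r + 1) D" and z: "z \<in> D" "\<not> jet_transverse_at r D \<S> g z"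
        by (auto simp: non_transverse_maps_def)
      have "delta r D \<S> f \<le> ennreal (dist (?J f z) (?J g z))"
        unfolding delta_def
      proof (rule INF_lower2[OF z(1)], rule INF_lower)
        show "?J g z \<in> non_transverse_jets r D \<S> z"
          using g z by (auto simp: non_transverse_jets_def)
      qed
      also have "dist (?J f z) (?J g z) = norm (snd (?J (\<lambda>x. f x - g x) z))"
        unfolding dist_jet_prolong jet_prolong_diff[OF f g z(1)] ..
      also have "ennreal \<dots> \<le> C_norm (r + 1) D (\<lambda>x. f x - g x)"
        unfolding C_norm_eq by (rule SUP_upper[OF z(1)])
      finally show "delta r D \<S> f \<le> C_norm (r + 1) D (\<lambda>x. f x - g x)" .
    qed
    \<comment> \<open>With the constant moved to the left, the infimum on the right can be bounded
      below term by term; this also covers an empty family of non-transverse jets, where the infimum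
      is infinite.\<close>
    have "C_dist_set (r + 1) D f (non_transverse_maps r D \<S>) / ennreal C \<le> delta r D \<S> f"
      unfolding delta_def
    proof (intro INF_greatest)
      fix z \<sigma>
      assume z: "z \<in> D" and "\<sigma> \<in> non_transverse_jets r D \<S> z"
      then obtain g where g: "g \<in> C_space (r + 1) D" "\<not> jet_transverse_at r D \<S> g z"
        and \<sigma>: "\<sigma> = ?J g z"
        by (auto simp: non_transverse_jets_def)
      define a where "a = snd (?J f z) - snd (?J g z)"
      have "a \<in> jet_space (r + 1)"
        using snd_jet_prolong_in_jet_space[of "r + 1" D f z] snd_jet_prolong_in_jet_space[of "r + 1" D g z]
        by (simp add: a_def jet_space_def)
      then obtain p where p: "p \<in> C_space (r + 1) D" "snd (?J p z) = a"
        "C_norm (r + 1) D p \<le> ennreal (C * norm a)"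
        using bump[OF convex_body_axioms z] by blast
      \<comment> \<open>By construction \<open>h\<close> has the jet of \<open>g\<close> at
        \<open>z\<close>, hence is not transverse there, while its distance from \<open>f\<close> is
        the norm of \<open>p\<close>.\<close>
      define h where "h x = f x - p x" for x
      have h: "h \<in> C_space (r + 1) D"
        using f p(1) Ck_on_diff unfolding h_def C_space_def by blast
      have "snd (?J h z) = snd (?J g z)"
        unfolding h_def jet_prolong_diff[OF f p(1) z] p(2) by (simp add: a_def)
      then have "?J h z = ?J g z"
        by (simp add: prod_eq_iff)
      then have "\<not> jet_transverse_at r D \<S> h z"
        using jet_transverse_at_cong[OF convex_body_axioms _ z, of h r g \<S>] h g by (simp add: D_eq)
      then have "h \<in> non_transverse_maps r D \<S>"
        using h z by (auto simp: non_transverse_maps_def)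
      then have "C_dist_set (r + 1) D f (non_transverse_maps r D \<S>) \<le> C_norm (r + 1) D (\<lambda>x. f x - h x)"
        unfolding C_dist_set_def by (rule INF_lower)
      also have "\<dots> \<le> ennreal (C * norm a)"
        using p(3) by (simp add: h_def)
      also have "\<dots> = ennreal C * ennreal (dist (?J f z) \<sigma>)"
        using C by (simp add: \<sigma> dist_jet_prolong a_def ennreal_mult)
      finally show "C_dist_set (r + 1) D f (non_transverse_maps r D \<S>) / ennreal C
          \<le> ennreal (dist (?J f z) \<sigma>)"
        using C by (simp add: divide_le_posI_ennreal mult.commute)
    qed
    then have "ennreal C * (C_dist_set (r + 1) D f (non_transverse_maps r D \<S>) / ennreal C)
        \<le> ennreal C * delta r D \<S> f"
      by (rule mult_left_mono) simp
    then show "C_dist_set (r + 1) D f (non_transverse_maps r D \<S>) \<le> ennreal C * delta r D \<S> f"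
      using C by (simp add: ennreal_times_divide mult.commute[of "ennreal C"] mult_divide_eq_ennreal)
  qed
  then show ?thesis
    using C by blast
qed

end
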